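(* Let $f\in\mathbf{B}_{k,n}$, $P\in\mathcal{P}_{k,n}$ and $i\in[n]$. (A) Suppose $\ell(s_ifs_i)=\ell(f)+2$. If $s_iP=P$, or $P_i=\mathrm R$ and $P_{i+1}=\mathrm U$, then there is a bijection $$\operatorname{Deo}_{f,P}\to\operatorname{Deo}_{s_if,\,s_iP}\sqcup\operatorname{Deo}_{s_ifs_i,\,s_iP}.$$ Otherwise, if $P_i=\mathrm U$ and $P_{i+1}=\mathrm R$, there is a bijection $$\operatorname{Deo}_{f,P}\to\operatorname{Deo}_{fs_i,\,s_iP}\sqcup\operatorname{Deo}_{s_ifs_i,\,s_iP}.$$ (B) Suppose $\ell(f)=\ell(s_ifs_i)$ with $s_if>f$ and $fs_i<f$. If $s_iP=P$, or $P_i=\mathrm R$ and $P_{i+1}=\mathrm U$, then there is a bijection $$\operatorname{Deo}_{f,P}\to\operatorname{Deo}_{s_ifs_i,\,s_iP}.$$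
   Context: Let $n\ge 2$, $0\le k\le n$, $[n]=\{1,\dots,n\}$. An $n$-periodic affine permutation is a bijection $f:\mathbb{Z}\to\mathbb{Z}$ with $f(i+n)=f(i)+n$ for all $i$. Products are read from left to right: $(fg)(a)=g(f(a))$. $\mathbf{B}_{k,n}$ is the set of those with $\frac1n\sum_{i=1}^n(f(i)-i)=k$ and $i\le f(i)\le i+n$ for all $i$. The length is $\ell(f)=\#\{(a,b): a\in[n],\,b\in\mathbb{Z},\,a<b,\,f(a)>f(b)\}$. $s_i$ is the affine permutation exchanging $i+mn$ and $i+1+mn$ for all $m\in\mathbb{Z}$ and fixing all other integers. We write $s_if>f$ (resp. $fs_i<f$) if $\ell(s_if)>\ell(f)$ (resp. $\ell(fs_i)<\ell(f)$). Lattice paths: $\mathcal{P}_{k,n}$ is the set of lattice paths $P$ from $(0,0)$ to $(n-k,k)$ with unit steps $P_1,\dots,P_n\in\{\mathrm R,\mathrm U\}$ (right, up); $s_iP$ is obtained by swapping the steps $P_i$ and $P_{i+1}$, indices modulo $n$. Extend $P$ to a bi-infinite path with steps indexed by $\mathbb{Z}$ via $P_{i+n}=P_i$ (step $1$ starts at $(0,0)$); it is invariant under translation by $(n-k,k)$. The strip of $P$ is the region between the extended path $P$ (southern boundary) and its translate $P+(0,k)$ (northern boundary). On each boundary the unit edges are labeled by $\mathbb{Z}$: the southern edge labeled $i$ is step $i$ of $P$, and the northern edge labeled $i$ is its translate by $(0,k)$. Fillings: a periodic filling assigns to each unit box of the strip a crossing or an elbow, invariantly under translation by $(n-k,k)$.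 Strands enter at the northern boundary edges and travel right/down: in a crossing box a strand entering from the left exits right and one entering from the top exits at the bottom; in an elbow box a strand entering from the left exits at the bottom and one entering from the top exits right. Each strand ends at a southern boundary edge; the strand permutation sends $i$ to $j$ if the strand entering at northern edge $i$ exits at southern edge $j$. For an $n$-periodic affine permutation $f$, $\operatorname{Deo}_{f,P}$ is the (finite, possibly empty) set of $(f,P)$-affine Deograms: periodic fillings with strand permutation $f$ such that whenever two strands form an elbow in a box, they have crossed each other an even number of times in boxes traversed before it (counting from the northern boundary). *)

theory Defs
  imports Complex_Main
begin

section \<open>Affine permutations\<close>

definition affine_perm :: "nat \<Rightarrow> (int \<Rightarrow> int) \<Rightarrow> bool" where
  "affine_perm n f \<longleftrightarrow> bij f \<and> (\<forall>i. f (i + int n) = f i + int n)"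

definition bounded_affine :: "nat \<Rightarrow> nat \<Rightarrow> (int \<Rightarrow> int) set" where
  "bounded_affine k n = {f. affine_perm n f
      \<and> real_of_int (\<Sum>i = 1..int n. f i - i) / real n = real k
      \<and> (\<forall>i. i \<le> f i \<and> f i \<le> i + int n)}"

text \<open>Products are read from left to right.\<close>

definition aff_mult :: "(int \<Rightarrow> int) \<Rightarrow> (int \<Rightarrow> int) \<Rightarrow> (int \<Rightarrow> int)" (infixl "\<cdot>" 70) where
  "f \<cdot> g = (\<lambda>a. g (f a))"

text \<open>The set below is finite whenever \<open>f\<close> is an \<open>n\<close>-periodic affine permutation, because then
  \<open>f i - i\<close> is bounded.\<close>

definition aff_length :: "nat \<Rightarrow> (int \<Rightarrow> int) \<Rightarrow> nat" where
  "aff_length n f = card {(a, b). a \<in> {1..int n} \<and> a < b \<and> f a > f b}"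

text \<open>The definition presupposes \<open>n \<ge> 2\<close>, so that \<open>i\<close> and \<open>i + 1\<close> are not congruent modulo \<open>n\<close>.\<close>

definition simple_refl :: "nat \<Rightarrow> int \<Rightarrow> int \<Rightarrow> int" where
  "simple_refl n i a =
     (if a mod int n = i mod int n then a + 1
      else if a mod int n = (i + 1) mod int n then a - 1
      else a)"

section \<open>Lattice paths and their strips\<close>

datatype step = Right | Up

text \<open>A path is the list of its steps; \<open>step_at\<close> is its periodic extension, with steps numbered
  from 1.\<close>

definition step_at :: "step list \<Rightarrow> int \<Rightarrow> step" where
  "step_at P i = P ! nat ((i - 1) mod int (length P))"

definition swap_steps :: "int \<Rightarrow> step list \<Rightarrow> step list" where
  "swap_steps i P =
     P[nat ((i - 1) mod int (length P)) := step_at P (i + 1),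
       nat (i mod int (length P)) := step_at P i]"

definition step_count :: "step list \<Rightarrow> step \<Rightarrow> int \<Rightarrow> int" where
  "step_count P c j =
     (if 0 \<le> j then int (card {i \<in> {1..j}. step_at P i = c})
      else - int (card {i \<in> {j + 1..0}. step_at P i = c}))"

text \<open>Step \<open>i\<close> of the extended path goes from vertex \<open>i - 1\<close> to vertex \<open>i\<close>, and vertex 0 is the
  origin.\<close>

definition vertex :: "step list \<Rightarrow> int \<Rightarrow> int \<times> int" where
  "vertex P j = (step_count P Right j, step_count P Up j)"

definition lattice_paths :: "nat \<Rightarrow> nat \<Rightarrow> step list set" where
  "lattice_paths k n = {P. length P = n \<and> vertex P (int n) = (int n - int k, int k)}"

text \<open>\<open>HEdge x y\<close> joins \<open>(x, y)\<close> to \<open>(x + 1, y)\<close>, and \<open>VEdge x y\<close> joins \<open>(x, y)\<close> to \<open>(x, y + 1)\<close>.\<close>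

datatype edge = HEdge int int | VEdge int int

definition south_edge :: "step list \<Rightarrow> int \<Rightarrow> edge" where
  "south_edge P i =
     (let (x, y) = vertex P (i - 1) in
      case step_at P i of Right \<Rightarrow> HEdge x y | Up \<Rightarrow> VEdge x y)"

definition north_edge :: "nat \<Rightarrow> step list \<Rightarrow> int \<Rightarrow> edge" where
  "north_edge k P i =
     (case south_edge P i of
        HEdge x y \<Rightarrow> HEdge x (y + int k)
      | VEdge x y \<Rightarrow> VEdge x (y + int k))"

text \<open>A unit box is given by its lower left corner. If the path has a horizontal edge
  \<open>HEdge x h\<close> over the column \<open>[x, x + 1]\<close>, then the boxes of the strip in this column are those
  between this edge and its translate \<open>HEdge x (h + k)\<close>. (For \<open>k = n\<close> there are no such edges and
  the strip has no boxes.)\<close>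

type_synonym box = "int \<times> int"

definition strip :: "nat \<Rightarrow> step list \<Rightarrow> box set" where
  "strip k P = {(x, y). \<exists>i h. south_edge P i = HEdge x h \<and> h \<le> y \<and> y < h + int k}"

section \<open>Periodic fillings, strands and affine Deograms\<close>

datatype tile = Crossing | Elbow

definition periodic_filling :: "nat \<Rightarrow> nat \<Rightarrow> step list \<Rightarrow> (box \<Rightarrow> tile option) \<Rightarrow> bool" where
  "periodic_filling k n P D \<longleftrightarrow>
     dom D = strip k P \<and> (\<forall>x y. D (x + (int n - int k), y + int k) = D (x, y))"

text \<open>Strands travel right and down: through a horizontal edge a strand enters the box below it
  (from the top), through a vertical edge it enters the box to its right (from the left).\<close>

fun entered_box :: "edge \<Rightarrow> box" where
  "entered_box (HEdge x y) = (x, y - 1)"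
| "entered_box (VEdge x y) = (x, y)"

text \<open>\<open>exit_edge t e\<close> is the edge through which a strand that came in through \<open>e\<close> leaves the
  box \<open>entered_box e\<close> if this box carries the tile \<open>t\<close>.\<close>

fun exit_edge :: "tile \<Rightarrow> edge \<Rightarrow> edge" where
  "exit_edge Crossing (VEdge x y) = VEdge (x + 1) y"
| "exit_edge Crossing (HEdge x y) = HEdge x (y - 1)"
| "exit_edge Elbow (VEdge x y) = HEdge x y"
| "exit_edge Elbow (HEdge x y) = VEdge (x + 1) (y - 1)"

text \<open>The \<open>m\<close>-th edge of the strand that enters at the northern edge \<open>i\<close>. The value is \<open>None\<close> once
  the strand has left the strip. The box entered through a southern boundary edge lies outside the
  strip, so a strand cannot continue beyond such an edge.\<close>

primrec strand :: "nat \<Rightarrow> step list \<Rightarrow> (box \<Rightarrow> tile option) \<Rightarrow> int \<Rightarrow> nat \<Rightarrow> edge option" where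
  "strand k P D i 0 = Some (north_edge k P i)"
| "strand k P D i (Suc m) =
     (case strand k P D i m of
        None \<Rightarrow> None
      | Some e \<Rightarrow> map_option (\<lambda>t. exit_edge t e) (D (entered_box e)))"

definition has_strand_perm ::
  "nat \<Rightarrow> step list \<Rightarrow> (box \<Rightarrow> tile option) \<Rightarrow> (int \<Rightarrow> int) \<Rightarrow> bool" where
  "has_strand_perm k P D f \<longleftrightarrow>
     (\<forall>i. \<exists>m. strand k P D i m = Some (south_edge P (f i)))"

definition traverses ::
  "nat \<Rightarrow> step list \<Rightarrow> (box \<Rightarrow> tile option) \<Rightarrow> int \<Rightarrow> nat \<Rightarrow> box \<Rightarrow> bool" where
  "traverses k P D i m b \<longleftrightarrow>
     b \<in> dom D \<and> (\<exists>e. strand k P D i m = Some e \<and> entered_box e = b)"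

text \<open>The boxes in which the strands \<open>i\<close> and \<open>j\<close> cross before the \<open>p\<close>-th box of the former and the
  \<open>q\<close>-th box of the latter (counting from 0).\<close>

definition crossings_before ::
  "nat \<Rightarrow> step list \<Rightarrow> (box \<Rightarrow> tile option) \<Rightarrow> int \<Rightarrow> nat \<Rightarrow> int \<Rightarrow> nat \<Rightarrow> box set" where
  "crossings_before k P D i p j q =
     {c. D c = Some Crossing
       \<and> (\<exists>p' < p. traverses k P D i p' c) \<and> (\<exists>q' < q. traverses k P D j q' c)}"

text \<open>Strands are indexed by all of \<open>\<int>\<close> and are not identified under translation, so the parity
  condition refers to pairs of distinct strands of the infinite strip.\<close>

definition Deo :: "nat \<Rightarrow> nat \<Rightarrow> (int \<Rightarrow> int) \<Rightarrow> step list \<Rightarrow> (box \<Rightarrow> tile option) set" where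
  "Deo k n f P = {D. periodic_filling k n P D \<and> has_strand_perm k P D f
     \<and> (\<forall>i j p q b. i \<noteq> j \<and> D b = Some Elbow \<and> traverses k P D i p b \<and> traverses k P D j q b
          \<longrightarrow> even (card (crossings_before k P D i p j q)))}"

end

theory Submission
  imports Defs
begin

text \<open>Cut the periodic strip open along all lattice paths between its two boundaries. Removing the box
  at an outer corner of the southern path either multiplies the strand permutation on the right by a
  simple reflection (crossing) or leaves it unchanged (elbow), and two strands have crossed an even
  number of times iff their order is preserved; so the elbow is allowed iff the reflection is a right
  ascent. Hence the vector of numbers of Deograms changes by an operator \<open>R\<^sub>j\<close>, right
  multiplication by a generator of the affine Hecke algebra at a parameter with
  \<open>R\<^sub>j\<^sup>2 = R\<^sub>j + 1\<close>. Since left multiplications \<open>L\<^sub>i\<close> commute with right ones, adding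
  a box to the northern path acts by \<open>L\<^sub>i\<close>. If the steps \<open>i, i + 1\<close> of \<open>P\<close> are right, up,
  then passing from \<open>P\<close> to \<open>s\<^sub>iP\<close> moves a box from the south to the north, so the vectors satisfy
  \<open>L\<^sub>i Z\<^sub>P = R\<^sub>i Z\<^sub>s\<^sub>i\<^sub>P\<close>. If the two steps are equal, the same identity with
  \<open>s\<^sub>iP = P\<close> follows by sliding the generator through two adjacent rows or columns of the strip by
  braid relations. Both parts are read off from its coefficients at \<open>s\<^sub>if\<close> and \<open>fs\<^sub>i\<close>.\<close>

section \<open>Affine permutations and simple reflections\<close>

text \<open>Only the existence of bijections between finite sets is claimed, so equal cardinalities
  suffice. Regions between two arbitrary periodic paths are needed because a strip with one orbit of
  boxes removed is no longer a strip. Strands are indexed by the antidiagonals of their end edges: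
  then the empty region has the identity as strand permutation, and removing a box relabels no other
  edge. The price is that the northern label \<open>i\<close> becomes \<open>i + k\<close>, the
  index carried by the left operators. Only boxes at the southern path are analysed through strands;
  the northern ones follow algebraically, since left and right operators agree on the unit vector at
  the identity. Two degenerate situations shape the hypotheses. For \<open>k = 0\<close> or
  \<open>k = n\<close> the paths are straight lines without corners, so different nested paths
  cannot be joined by removing boxes. For \<open>n = 2\<close> there is no braid relation, but two
  equal neighbouring steps then occur only for \<open>k = 0\<close> or \<open>k = n\<close>, where
  the strip is empty.\<close>

lemma mod_eq_add_iff:
  fixes a b c :: int
  shows "(a + c) mod m = (b + c) mod m \<longleftrightarrow> a mod m = b mod m"
  by (simp add: mod_eq_dvd_iff)

lemma succ_mod_neq:
  assumes "n \<ge> 2" shows "(a + 1) mod int n \<noteq> a mod int n"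
proof
  assume "(a + 1) mod int n = a mod int n"
  then have "int n dvd 1" by (simp add: mod_eq_dvd_iff)
  then show False using assms by simp
qed

lemma simple_refl_left:
  "a mod int n = i mod int n \<Longrightarrow> simple_refl n i a = a + 1"
  by (simp add: simple_refl_def)

lemma simple_refl_right:
  assumes "n \<ge> 2" "a mod int n = (i + 1) mod int n"
  shows "simple_refl n i a = a - 1"
  using assms succ_mod_neq[OF assms(1), of i] by (simp add: simple_refl_def)

lemma simple_refl_other:
  "a mod int n \<noteq> i mod int n \<Longrightarrow> a mod int n \<noteq> (i + 1) mod int n \<Longrightarrow> simple_refl n i a = a"
  by (simp add: simple_refl_def)

lemma simple_refl_cong:
  "i mod int n = j mod int n \<Longrightarrow> simple_refl n i = simple_refl n j"
  using mod_eq_add_iff[of i 1 "int n" j] by (auto simp: simple_refl_def fun_eq_iff)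

lemma simple_refl_cases [consumes 1, case_names left right other]:
  assumes "n \<ge> 2"
  obtains (left) "a mod int n = i mod int n" "simple_refl n i a = a + 1"
  | (right) "(a - 1) mod int n = i mod int n" "simple_refl n i a = a - 1"
  | (other) "a mod int n \<noteq> i mod int n" "(a - 1) mod int n \<noteq> i mod int n" "simple_refl n i a = a"
  using simple_refl_left simple_refl_right[OF assms] simple_refl_other
    mod_eq_add_iff[of "a - 1" 1 "int n" i]
  by (metis diff_add_cancel)

lemma simple_refl_alt:
  "simple_refl n i a = (if a mod int n = i mod int n then a + 1
     else if (a - 1) mod int n = i mod int n then a - 1 else a)"
  using mod_eq_add_iff[of "a - 1" 1 "int n" i] by (simp add: simple_refl_def)

lemma simple_refl_invol:
  assumes "n \<ge> 2" shows "simple_refl n i (simple_refl n i a) = a"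
using assms proof (cases rule: simple_refl_cases[where a = a and i = i])
  case left
  then have "(a + 1) mod int n = (i + 1) mod int n" by (simp add: mod_eq_add_iff)
  then show ?thesis using left simple_refl_right[OF assms] by simp
next
  case right
  then show ?thesis using simple_refl_left by simp
qed simp

text \<open>Integers move by at most 1, so only distances 1 and 2 matter. At distance 2 the images
  could collide only if \<open>a\<close> moved up and \<open>a + 2\<close> down, and then
  \<open>a\<close> and \<open>a + 1\<close> would both be congruent to \<open>i\<close>. The same
  fact governs lengths, ascents and the parity of crossings.\<close>

lemma simple_refl_less_iff:
  assumes "n \<ge> 2" "a < b"
  shows "simple_refl n i a < simple_refl n i b \<longleftrightarrow> \<not> (b = a + 1 \<and> a mod int n = i mod int n)"
proof -
  define p where "p x \<longleftrightarrow> x mod int n = i mod int n" for x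
  have p: "\<not> (p x \<and> p (x + 1))" for x
    using succ_mod_neq[OF assms(1)] by (metis p_def)
  note s = simple_refl_alt[of n i, folded p_def]
  consider "b = a + 1" | "b = a + 2" | "b > a + 2" using assms(2) by linarith
  then have "simple_refl n i a < simple_refl n i b \<longleftrightarrow> \<not> (b = a + 1 \<and> p a)"
    using p[of a] p[of "a - 1"] p[of "a + 1"] by cases (auto simp: s add.commute)
  then show ?thesis by (simp add: p_def)
qed

lemma simple_refl_periodic: "simple_refl n i (a + int n) = simple_refl n i a + int n"
  by (simp add: simple_refl_def)

lemma affine_perm_simple_refl:
  assumes "n \<ge> 2" shows "affine_perm n (simple_refl n i)"
proof -
  have "bij (simple_refl n i)"
    using simple_refl_invol[OF assms] by (metis bij_iff)
  then show ?thesis by (simp add: affine_perm_def simple_refl_periodic)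
qed

lemma affine_perm_mult:
  assumes "affine_perm n f" "affine_perm n g" shows "affine_perm n (f \<cdot> g)"
proof -
  have "bij (g \<circ> f)" using assms by (auto simp: affine_perm_def intro: bij_comp)
  then show ?thesis using assms by (simp add: affine_perm_def aff_mult_def comp_def)
qed

lemma affine_perm_inv:
  assumes "affine_perm n f" shows "affine_perm n (inv f)"
proof -
  have b: "bij f" and p: "\<And>i. f (i + int n) = f i + int n"
    using assms by (auto simp: affine_perm_def)
  have "inv f (i + int n) = inv f i + int n" for i
    using b p[of "inv f i"] by (metis bij_inv_eq_iff)
  then show ?thesis using b by (simp add: affine_perm_def bij_imp_bij_inv)
qed

lemma affine_perm_add_mult:
  assumes "affine_perm n f" shows "f (a + m * int n) = f a + m * int n"
proof (induction m rule: int_induct[where k = 0])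
  case (step1 m)
  then show ?case using assms unfolding affine_perm_def
    by (metis (no_types, opaque_lifting) add.assoc distrib_right mult_1)
next
  case (step2 m)
  have "f (a + (m - 1) * int n + int n) = f (a + (m - 1) * int n) + int n"
    using assms by (simp add: affine_perm_def)
  then show ?case using step2 by (simp add: algebra_simps)
qed simp

lemma mod_eqE:
  fixes a b m :: int
  assumes "a mod m = b mod m" obtains t where "a = b + t * m"
  using assms by (metis mod_eqE mult.commute)

lemma affine_perm_mod_eq_iff:
  assumes "affine_perm n f"
  shows "f a mod int n = f b mod int n \<longleftrightarrow> a mod int n = b mod int n"
proof -
  have *: "f a mod int n = f b mod int n"
    if f: "affine_perm n f" and ab: "a mod int n = b mod int n" for f a b
  proof -
    obtain t where "a = b + t * int n" using mod_eqE[OF ab] .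
    then show ?thesis using affine_perm_add_mult[OF f, of b t] by simp
  qed
  have "inv f (f a) = a" "inv f (f b) = b" using assms by (simp_all add: affine_perm_def bij_is_inj)
  then show ?thesis
    using *[OF assms, of a b] *[OF affine_perm_inv[OF assms], of "f a" "f b"] by auto
qed

lemma simple_refl_conj_shift:
  "simple_refl n (i + c) a = simple_refl n i (a - c) + c"
  using mod_eq_add_iff[of "a - c" c "int n" i] mod_eq_add_iff[of "a - c" c "int n" "i + 1"]
  by (simp add: simple_refl_def add.commute add.left_commute add.assoc)

lemma aff_mult_assoc: "f \<cdot> g \<cdot> h = f \<cdot> (g \<cdot> h)"
  by (simp add: aff_mult_def)

lemma simple_refl_mult_self:
  assumes "n \<ge> 2"
  shows "simple_refl n i \<cdot> (simple_refl n i \<cdot> g) = g" "f \<cdot> simple_refl n i \<cdot> simple_refl n i = f"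
  using simple_refl_invol[OF assms] by (simp_all add: aff_mult_def)

lemma simple_refl_commute:
  assumes n: "n \<ge> 2"
    and ij: "i mod int n \<noteq> j mod int n" "(i + 1) mod int n \<noteq> j mod int n" "i mod int n \<noteq> (j + 1) mod int n"
  shows "simple_refl n i \<cdot> simple_refl n j = simple_refl n j \<cdot> simple_refl n i"
proof
  fix a
  define p where "p x \<longleftrightarrow> x mod int n = i mod int n" for x
  define q where "q x \<longleftrightarrow> x mod int n = j mod int n" for x
  have pq: "\<not> (p x \<and> p (x + 1))" "\<not> (q x \<and> q (x + 1))" "\<not> (p x \<and> q x)" for x
    using succ_mod_neq[OF n] ij(1) by (metis p_def q_def)+
  have pq1: "\<not> (p x \<and> q (x + 1))" "\<not> (q x \<and> p (x + 1))" for x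
    using ij mod_eq_add_iff[of x 1 "int n"] by (metis p_def q_def)+
  note s = simple_refl_alt[of n i, folded p_def] simple_refl_alt[of n j, folded q_def]
  show "(simple_refl n i \<cdot> simple_refl n j) a = (simple_refl n j \<cdot> simple_refl n i) a"
    using pq[of a] pq[of "a - 1"] pq1[of a] pq1[of "a - 1"] pq1[of "a - 2"] pq[of "a - 2"]
    by (simp add: aff_mult_def s) blast
qed

lemma simple_refl_braid:
  assumes n: "n \<ge> 3"
  shows "simple_refl n i \<cdot> simple_refl n (i + 1) \<cdot> simple_refl n i
       = simple_refl n (i + 1) \<cdot> simple_refl n i \<cdot> simple_refl n (i + 1)"
proof
  fix a
  define p where "p x \<longleftrightarrow> x mod int n = i mod int n" for x
  \<comment> \<open>Here \<open>n \<ge> 3\<close> enters: \<open>i\<close>, \<open>i + 1\<close> and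
    \<open>i + 2\<close> lie in three different classes. For \<open>n = 2\<close> the two generators
    satisfy no braid relation.\<close>
  have "\<not> int n dvd 1" "\<not> int n dvd 2" using n zdvd_imp_le[of "int n" 2] by auto
  then have p: "\<not> (p x \<and> p (x + 1))" "\<not> (p x \<and> p (x + 2))" for x
    by (auto simp: p_def mod_eq_dvd_iff dest: dvd_diff[of "int n" "x + 1 - i" "x - i"]
      dvd_diff[of "int n" "x + 2 - i" "x - i"])
  have q: "x mod int n = (i + 1) mod int n \<longleftrightarrow> p (x - 1)" for x
    using mod_eq_add_iff[of "x - 1" 1 "int n" i] by (simp add: p_def)
  define t where "t = simple_refl n (i + 1)"
  have t: "t x = (if p (x - 1) then x + 1 else if p (x - 2) then x - 1 else x)" for x
    using simple_refl_alt[of n "i + 1" x] q[of x] q[of "x - 1"] by (simp add: t_def)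
  note s = simple_refl_alt[of n i, folded p_def] t
  have "(simple_refl n i \<cdot> t \<cdot> simple_refl n i) a = (t \<cdot> simple_refl n i \<cdot> t) a"
    using p[of a] p[of "a - 1"] p[of "a - 2"] p[of "a - 3"] p[of "a - 4"]
    by (simp add: aff_mult_def s add.commute) blast
  then show "(simple_refl n i \<cdot> simple_refl n (i + 1) \<cdot> simple_refl n i) a
       = (simple_refl n (i + 1) \<cdot> simple_refl n i \<cdot> simple_refl n (i + 1)) a"
    by (simp only: t_def)
qed

lemma inv_aff_mult:
  assumes "affine_perm n f" "affine_perm n g"
  shows "inv (f \<cdot> g) = inv g \<cdot> inv f"
  using o_inv_distrib[of g f] assms by (simp add: aff_mult_def affine_perm_def comp_def)

lemma inv_simple_refl: "n \<ge> 2 \<Longrightarrow> inv (simple_refl n i) = simple_refl n i"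
  using simple_refl_invol by (metis inv_equality)

lemma inv_mult_simple_refl:
  assumes "n \<ge> 2" "affine_perm n g"
  shows "inv (g \<cdot> simple_refl n j) a = inv g (simple_refl n j a)"
  using inv_aff_mult[OF assms(2) affine_perm_simple_refl[OF assms(1)]] inv_simple_refl[OF assms(1)]
  by (simp add: aff_mult_def)

section \<open>Operators of the Hecke algebra\<close>

text \<open>These act on functions on the affine symmetric group, extended by \<open>0\<close> to all functions on
  \<open>\<int>\<close>; the guard makes the relations below hold as equations of functions.\<close>

definition mult_left :: "nat \<Rightarrow> int \<Rightarrow> ((int \<Rightarrow> int) \<Rightarrow> nat) \<Rightarrow> (int \<Rightarrow> int) \<Rightarrow> nat" where
  "mult_left n i c g =
     (if affine_perm n g then c (simple_refl n i \<cdot> g) + (if g i < g (i + 1) then c g else 0) else 0)"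

definition mult_right :: "nat \<Rightarrow> int \<Rightarrow> ((int \<Rightarrow> int) \<Rightarrow> nat) \<Rightarrow> (int \<Rightarrow> int) \<Rightarrow> nat" where
  "mult_right n i c g =
     (if affine_perm n g
      then c (g \<cdot> simple_refl n i) + (if inv g i < inv g (i + 1) then c g else 0) else 0)"

lemma affine_perm_less_cong:
  assumes "affine_perm n g" "i mod int n = j mod int n"
  shows "g i < g (i + 1) \<longleftrightarrow> g j < g (j + 1)"
proof -
  obtain t where "i = j + t * int n" using mod_eqE[OF assms(2)] .
  then show ?thesis
    using affine_perm_add_mult[OF assms(1), of j t] affine_perm_add_mult[OF assms(1), of "j + 1" t]
    by (simp add: algebra_simps)
qed

lemma mult_left_cong:
  assumes "i mod int n = j mod int n" shows "mult_left n i = mult_left n j"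
proof
  fix c show "mult_left n i c = mult_left n j c"
    using affine_perm_less_cong[OF _ assms]
    by (intro ext) (simp add: mult_left_def simple_refl_cong[OF assms])
qed

lemma mult_right_cong:
  assumes "i mod int n = j mod int n" shows "mult_right n i = mult_right n j"
proof
  fix c show "mult_right n i c = mult_right n j c"
    using affine_perm_less_cong[OF affine_perm_inv assms]
    by (intro ext) (simp add: mult_right_def simple_refl_cong[OF assms])
qed

text \<open>Exchange property: a reflection changes the order of two values only if it interchanges
  exactly these two. So the left ascent at \<open>i\<close> can change only when the reflection of
  \<open>j\<close> interchanges \<open>g i\<close> and \<open>g (i + 1)\<close>, and then
  periodicity makes the two products equal.\<close>

lemma less_mult_simple_refl_iff:
  assumes n: "n \<ge> 2" and g: "affine_perm n g"
    and neq: "simple_refl n i \<cdot> g \<noteq> g \<cdot> simple_refl n j"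
  shows "(g \<cdot> simple_refl n j) i < (g \<cdot> simple_refl n j) (i + 1) \<longleftrightarrow> g i < g (i + 1)"
proof (rule ccontr)
  assume contra: "\<not> ?thesis"
  \<comment> \<open>Away from the classes of \<open>i\<close> and \<open>i + 1\<close> the values of
    \<open>g\<close> avoid the classes of \<open>j\<close> and \<open>j + 1\<close>, so both
    products equal \<open>g\<close> there.\<close>
  have conj: "simple_refl n i \<cdot> g = g \<cdot> simple_refl n j"
    if swap: "simple_refl n j (g i) = g (i + 1)" "simple_refl n j (g (i + 1)) = g i"
     and nr: "g i mod int n = j mod int n \<and> g (i + 1) mod int n = (j + 1) mod int n \<or>
              g (i + 1) mod int n = j mod int n \<and> g i mod int n = (j + 1) mod int n"
  proof
    fix a
    have *: "simple_refl n j (g (b + t * int n)) = simple_refl n j (g b) + t * int n" for b t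
      by (simp add: affine_perm_add_mult[OF g] affine_perm_add_mult[OF affine_perm_simple_refl[OF n]])
    show "(simple_refl n i \<cdot> g) a = (g \<cdot> simple_refl n j) a"
    using n proof (cases rule: simple_refl_cases[where a = a and i = i])
      case left
      obtain t where t: "a = i + t * int n" using mod_eqE[OF left(1)] .
      then show ?thesis using left * [of i t] affine_perm_add_mult[OF g, of "i + 1" t] swap
        by (simp add: aff_mult_def algebra_simps)
    next
      case right
      obtain t where "a - 1 = i + t * int n" using mod_eqE[OF right(1)] .
      then have t: "a = (i + 1) + t * int n" by simp
      then show ?thesis using right * [of "i + 1" t] affine_perm_add_mult[OF g, of i t] swap
        by (simp add: aff_mult_def algebra_simps)
    next
      case other
      have "(a - 1 + 1) mod int n \<noteq> (i + 1) mod int n" using other(2) mod_eq_add_iff by blast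
      then have "g a mod int n \<noteq> g i mod int n" "g a mod int n \<noteq> g (i + 1) mod int n"
        using other(1) affine_perm_mod_eq_iff[OF g] by auto
      then have "g a mod int n \<noteq> j mod int n" "g a mod int n \<noteq> (j + 1) mod int n"
        using nr by auto
      then show ?thesis using other simple_refl_other by (simp add: aff_mult_def)
    qed
  qed
  have inj: "g i \<noteq> g (i + 1)" using g by (auto simp: affine_perm_def bij_def dest: injD)
  show False
  proof (cases "g i < g (i + 1)")
    case True
    then have "g (i + 1) = g i + 1" "g i mod int n = j mod int n"
      using contra simple_refl_less_iff[OF n True, of j] by (auto simp: aff_mult_def)
    then show False
      using conj neq simple_refl_left simple_refl_right[OF n] mod_eq_add_iff
      by (metis add_diff_cancel_right')
  next
    case False
    then have less: "g (i + 1) < g i" using inj by simp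
    have "simple_refl n j (g i) \<noteq> simple_refl n j (g (i + 1))"
      using inj simple_refl_invol[OF n] by metis
    then have "g i = g (i + 1) + 1" "g (i + 1) mod int n = j mod int n"
      using contra simple_refl_less_iff[OF n less, of j] less by (auto simp: aff_mult_def)
    then show False
      using conj neq simple_refl_left simple_refl_right[OF n] mod_eq_add_iff
      by (metis add_diff_cancel_right')
  qed
qed

text \<open>If the two products with \<open>g\<close> differ, neither multiplication affects the
  ascent tested by the other, and both sides expand into the same terms. If they agree, the
  multiplication reverses both ascents, and it remains to see that \<open>g\<close> has a left
  ascent at \<open>i\<close> iff it has a right ascent at \<open>j\<close>.\<close>

lemma mult_left_right_commute:
  assumes n: "n \<ge> 2"
  shows "mult_left n i (mult_right n j c) = mult_right n j (mult_left n i c)"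
proof
  fix g
  let ?s = "simple_refl n i" and ?t = "simple_refl n j"
  note aff = affine_perm_mult affine_perm_simple_refl[OF n] affine_perm_inv
  show "mult_left n i (mult_right n j c) g = mult_right n j (mult_left n i c) g"
  proof (cases "affine_perm n g")
    case g: True
    have inv1: "inv (?s \<cdot> g) = inv g \<cdot> ?s"
      using inv_aff_mult[OF aff(2) g] inv_simple_refl[OF n] by simp
    show ?thesis
    proof (cases "?s \<cdot> g = g \<cdot> ?t")
      case False
      then have "?t \<cdot> inv g \<noteq> inv g \<cdot> ?s"
        using inv_aff_mult[OF aff(2) g, of i] inv_aff_mult[OF g aff(2), of j] inv_simple_refl[OF n]
          aff(1)[OF aff(2) g, of i] aff(1)[OF g aff(2), of j]
        by (metis affine_perm_def inv_inv_eq)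
      then show ?thesis
        using less_mult_simple_refl_iff[OF n g False] less_mult_simple_refl_iff[OF n affine_perm_inv[OF g], of j i] g
        by (simp add: mult_left_def mult_right_def aff inv1 aff_mult_assoc)
    next
      case True
      have gi: "?t (g i) = g (i + 1)"
        using fun_cong[OF True, of i] simple_refl_left[of i n i] by (simp add: aff_mult_def)
      have gi': "?t (g (i + 1)) = g i"
        using fun_cong[OF True, of "i + 1"] simple_refl_right[OF n, of "i + 1" i] by (simp add: aff_mult_def)
      have "inv (?s \<cdot> g) = inv (g \<cdot> ?t)" using True by simp
      then have T: "inv g \<cdot> ?s = ?t \<cdot> inv g"
        using inv1 inv_aff_mult[OF g aff(2), of j] inv_simple_refl[OF n] by simp
      have hj: "?s (inv g j) = inv g (j + 1)" "?s (inv g (j + 1)) = inv g j"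
        using fun_cong[OF T, of j] fun_cong[OF T, of "j + 1"] simple_refl_left[of j n j]
         simple_refl_right[OF n, of "j + 1" j] by (simp_all add: aff_mult_def)
      have inj: "g i \<noteq> g (i + 1)" "inv g j \<noteq> inv g (j + 1)"
        using g affine_perm_inv[OF g] by (auto simp: affine_perm_def bij_def dest: injD)
      have ne: "\<not> (b mod int n = m \<and> (b - 1) mod int n = m)" for b m
        using succ_mod_neq[OF n, of "b - 1"] by auto
      \<comment> \<open>\<open>g i\<close> and \<open>g (i + 1)\<close> are neighbours interchanged
        by \<open>?t\<close>, so their order is decided by whether \<open>g i\<close> is congruent
        to \<open>j\<close>. The corresponding test for \<open>inv g j\<close> is the image of this
        one under \<open>inv g\<close>.\<close>
      have iff: "g i < g (i + 1) \<longleftrightarrow> inv g j < inv g (j + 1)"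
      proof -
        have "g i < g (i + 1) \<longleftrightarrow> g i mod int n = j mod int n"
          using n gi gi' by (cases rule: simple_refl_cases[where a = "g i" and i = j])
            (use inj(1) ne[of "g i"] in auto)
        moreover have "inv g j < inv g (j + 1) \<longleftrightarrow> inv g j mod int n = i mod int n"
          using n hj by (cases rule: simple_refl_cases[where a = "inv g j" and i = i])
            (use inj(2) ne[of "inv g j"] in auto)
        moreover have "g i mod int n = j mod int n \<longleftrightarrow> inv g j mod int n = i mod int n"
          using affine_perm_mod_eq_iff[OF affine_perm_inv[OF g], of "g i" j] g
          by (auto simp: affine_perm_def bij_is_inj)
        ultimately show ?thesis by simp
      qed
      have "(?s \<cdot> g) i = g (i + 1)" "(?s \<cdot> g) (i + 1) = g i"
        using gi gi' True by (simp_all add: aff_mult_def)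
      moreover have "(inv g \<cdot> ?s) j = inv g (j + 1)" "(inv g \<cdot> ?s) (j + 1) = inv g j"
        using hj by (simp_all add: aff_mult_def)
      ultimately show ?thesis
        using g inj iff
        by (auto simp: mult_left_def mult_right_def aff inv1 aff_mult_assoc True[symmetric])
    qed
  qed (simp add: mult_left_def mult_right_def)
qed

lemma mult_right_commute:
  assumes n: "n \<ge> 2"
    and ij: "i mod int n \<noteq> j mod int n" "(i + 1) mod int n \<noteq> j mod int n" "i mod int n \<noteq> (j + 1) mod int n"
  shows "mult_right n i (mult_right n j c) = mult_right n j (mult_right n i c)"
proof
  fix g
  note aff = affine_perm_mult affine_perm_simple_refl[OF n]
  have "(i + 1) mod int n \<noteq> (j + 1) mod int n" using ij mod_eq_add_iff by blast
  then have "simple_refl n i j = j" "simple_refl n i (j + 1) = j + 1"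
    "simple_refl n j i = i" "simple_refl n j (i + 1) = i + 1"
    using ij by (auto simp: simple_refl_def)
  moreover have "g \<cdot> simple_refl n i \<cdot> simple_refl n j = g \<cdot> simple_refl n j \<cdot> simple_refl n i"
    using simple_refl_commute[OF assms] by (simp add: aff_mult_assoc)
  ultimately show "mult_right n i (mult_right n j c) g = mult_right n j (mult_right n i c) g"
    by (simp add: mult_right_def aff inv_mult_simple_refl[OF n])
qed

lemma mult_right_braid:
  assumes n: "n \<ge> 3"
  shows "mult_right n i (mult_right n (i + 1) (mult_right n i c))
       = mult_right n (i + 1) (mult_right n i (mult_right n (i + 1) c))"
proof
  fix g
  have n2: "n \<ge> 2" using n by simp
  let ?s = "simple_refl n i" and ?t = "simple_refl n (i + 1)"
  note aff = affine_perm_mult affine_perm_simple_refl[OF n2]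
  have neq: "i mod int n \<noteq> (i + 1) mod int n" "(i + 1) mod int n \<noteq> (i + 2) mod int n"
     "i mod int n \<noteq> (i + 2) mod int n"
    using n zdvd_imp_le[of "int n" 2] zdvd_imp_le[of "int n" 1] by (auto simp: mod_eq_dvd_iff)
  have i2: "i + 1 + 1 = i + 2" by simp
  have s: "?s i = i + 1" "?s (i + 1) = i" "?s (i + 2) = i + 2"
    "?t i = i" "?t (i + 1) = i + 2" "?t (i + 2) = i + 1"
    using neq by (simp_all add: simple_refl_def add.assoc)
  show "mult_right n i (mult_right n (i + 1) (mult_right n i c)) g
       = mult_right n (i + 1) (mult_right n i (mult_right n (i + 1) c)) g"
  proof (cases "affine_perm n g")
    case g: True
    \<comment> \<open>Right multiplication by the two reflections only permutes the positions of the
      values \<open>i\<close>, \<open>i + 1\<close>, \<open>i + 2\<close>. So every ascent condition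
      in the expansion compares two of these three positions, and the relation is checked for each
      order of them.\<close>
    define p q r where "p = inv g i" and "q = inv g (i + 1)" and "r = inv g (i + 2)"
    note inv = inv_mult_simple_refl[OF n2]
    have R: "mult_right n j c h = c (h \<cdot> simple_refl n j) + (if inv h j < inv h (j + 1) then c h else 0)"
      if "affine_perm n h" for c h j
      using that by (simp add: mult_right_def)
    have aff_words: "affine_perm n (g \<cdot> ?s)" "affine_perm n (g \<cdot> ?t)" "affine_perm n (g \<cdot> ?s \<cdot> ?t)"
      "affine_perm n (g \<cdot> ?t \<cdot> ?s)"
      using g aff by blast+
    have S: "mult_right n i \<phi> g = \<phi> (g \<cdot> ?s) + (if p < q then \<phi> g else 0)"
      "mult_right n i \<phi> (g \<cdot> ?s) = \<phi> g + (if q < p then \<phi> (g \<cdot> ?s) else 0)"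
      "mult_right n i \<phi> (g \<cdot> ?t) = \<phi> (g \<cdot> ?t \<cdot> ?s) + (if p < r then \<phi> (g \<cdot> ?t) else 0)"
      "mult_right n i \<phi> (g \<cdot> ?s \<cdot> ?t) = \<phi> (g \<cdot> ?s \<cdot> ?t \<cdot> ?s) + (if q < r then \<phi> (g \<cdot> ?s \<cdot> ?t) else 0)"
      for \<phi>
      by (simp_all only: R g aff_words inv s simple_refl_mult_self[OF n2] p_def q_def r_def)
    have T: "mult_right n (i + 1) \<phi> g = \<phi> (g \<cdot> ?t) + (if q < r then \<phi> g else 0)"
      "mult_right n (i + 1) \<phi> (g \<cdot> ?t) = \<phi> g + (if r < q then \<phi> (g \<cdot> ?t) else 0)"
      "mult_right n (i + 1) \<phi> (g \<cdot> ?s) = \<phi> (g \<cdot> ?s \<cdot> ?t) + (if p < r then \<phi> (g \<cdot> ?s) else 0)"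
      "mult_right n (i + 1) \<phi> (g \<cdot> ?t \<cdot> ?s) = \<phi> (g \<cdot> ?t \<cdot> ?s \<cdot> ?t) + (if p < q then \<phi> (g \<cdot> ?t \<cdot> ?s) else 0)"
      for \<phi>
      by (simp_all only: R g aff_words inv s i2 simple_refl_mult_self[OF n2] p_def q_def r_def)
    have braid: "g \<cdot> ?t \<cdot> ?s \<cdot> ?t = g \<cdot> ?s \<cdot> ?t \<cdot> ?s"
      using simple_refl_braid[OF n, of i] by (simp only: aff_mult_assoc)
    have "inj (inv g)" using affine_perm_inv[OF g] by (simp add: affine_perm_def bij_def)
    then have "p \<noteq> q" "q \<noteq> r" "p \<noteq> r" by (simp_all add: p_def q_def r_def inj_eq)
    then show ?thesis
      unfolding S T braid
      by (cases "p < q"; cases "q < r"; cases "p < r"; simp)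
  qed (simp add: mult_right_def)
qed

section \<open>Lengths\<close>

text \<open>\<open>S\<close> is a union of orbits of the diagonal translation by \<open>n\<close>,
  and each orbit has exactly one element in each window, so both sides count orbits.\<close>

lemma card_orbit_representatives:
  fixes S :: "(int \<times> int) set" and u v :: "int \<times> int \<Rightarrow> int"
  assumes n: "n \<ge> 1"
    and S: "\<And>a b. (a + int n, b + int n) \<in> S \<longleftrightarrow> (a, b) \<in> S"
    and u: "\<And>a b. u (a + int n, b + int n) = u (a, b) + int n"
    and v: "\<And>a b. v (a + int n, b + int n) = v (a, b) + int n"
  shows "card {p \<in> S. u p \<in> {1..int n}} = card {p \<in> S. v p \<in> {1..int n}}"
proof -
  define sh where "sh t p = (fst p + t * int n, snd p + t * int n)" for t p
  have sh_add: "sh t (sh t' p) = sh (t + t') p" for t t' p by (simp add: sh_def algebra_simps)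
  have sh0: "sh 0 p = p" for p by (simp add: sh_def)
  have sh1: "sh 1 p = (fst p + int n, snd p + int n)" for p by (simp add: sh_def)
  have shift: "w (sh t p) = w p + t * int n"
    if "\<And>a b. w (a + int n, b + int n) = w (a, b) + int n" for w :: "int \<times> int \<Rightarrow> int" and t p
  proof (induction t rule: int_induct[where k = 0])
    case (step1 t)
    have "w (sh (t + 1) p) = w (sh 1 (sh t p))" by (simp add: sh_add add.commute)
    then show ?case using step1 by (simp add: sh1 that distrib_right)
  next
    case (step2 t)
    have "w (sh t p) = w (sh 1 (sh (t - 1) p))" by (simp add: sh_add)
    then show ?case using step2 by (simp add: sh1 that left_diff_distrib)
  qed (simp add: sh0)
  have Ssh: "sh t p \<in> S \<longleftrightarrow> p \<in> S" for t p
  proof (induction t rule: int_induct[where k = 0])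
    case (step1 t)
    have "sh (t + 1) p = sh 1 (sh t p)" by (simp add: sh_add add.commute)
    then show ?case using S step1 by (simp add: sh1)
  next
    case (step2 t)
    have "sh t p = sh 1 (sh (t - 1) p)" by (simp add: sh_add)
    then show ?case using S step2 by (simp add: sh1)
  qed (simp add: sh0)
  \<comment> \<open>This is the translate of \<open>p\<close> that lies in the window of
    \<open>w\<close>.\<close>
  define N where "N w p = sh (- ((w p - 1) div int n)) p" for w :: "int \<times> int \<Rightarrow> int" and p
  have range_N: "w (N w p) \<in> {1..int n}" and N_N: "w' p \<in> {1..int n} \<Longrightarrow> N w' (N w p) = p"
    if w: "\<And>a b. w (a + int n, b + int n) = w (a, b) + int n"
      and w': "\<And>a b. w' (a + int n, b + int n) = w' (a, b) + int n" for w w' p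
  proof -
    have "w (N w p) - 1 = (w p - 1) mod int n"
      by (simp add: N_def shift[of w, OF w] minus_div_mult_eq_mod[symmetric])
    moreover have "0 \<le> (w p - 1) mod int n" "(w p - 1) mod int n < int n" using n by simp_all
    ultimately show "w (N w p) \<in> {1..int n}" by simp
    assume "w' p \<in> {1..int n}"
    then have z: "(w' p - 1) div int n = 0" by simp
    define t where "t = - ((w p - 1) div int n)"
    have "w' (N w p) - 1 = (w' p - 1) + t * int n"
      by (simp add: N_def shift[of w', OF w'] t_def)
    then have "(w' (N w p) - 1) div int n = t"
      using z n div_mult_self1[of "int n" "w' p - 1" t] by (simp only:)
    then show "N w' (N w p) = p" unfolding N_def[of w']
      by (simp add: N_def sh_add t_def sh0)
  qed
  have "bij_betw (N v) {p \<in> S. u p \<in> {1..int n}} {p \<in> S. v p \<in> {1..int n}}"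
  proof (rule bij_betw_byWitness[where f' = "N u"])
    show "\<forall>p\<in>{p \<in> S. u p \<in> {1..int n}}. N u (N v p) = p" using N_N[of v u] u v by blast
    show "\<forall>p\<in>{p \<in> S. v p \<in> {1..int n}}. N v (N u p) = p" using N_N[of u v] u v by blast
    show "N v ` {p \<in> S. u p \<in> {1..int n}} \<subseteq> {p \<in> S. v p \<in> {1..int n}}"
      using range_N[of v v] v Ssh by (auto simp: N_def)
    show "N u ` {p \<in> S. v p \<in> {1..int n}} \<subseteq> {p \<in> S. u p \<in> {1..int n}}"
      using range_N[of u u] u Ssh by (auto simp: N_def)
  qed
  then show ?thesis by (rule bij_betw_same_card)
qed

definition inversions :: "(int \<Rightarrow> int) \<Rightarrow> (int \<times> int) set" where
  "inversions f = {(a, b). a < b \<and> f a > f b}"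

text \<open>Lets the window be carried along by a map of inversions: below it is attached to the
  reflected first entry or to \<open>f\<close> of the second entry.\<close>

lemma aff_length_eq_card_representatives:
  assumes "n \<ge> 1" and f: "affine_perm n f"
    and u: "\<And>a b. u (a + int n, b + int n) = u (a, b) + int n"
  shows "aff_length n f = card {p \<in> inversions f. u p \<in> {1..int n}}"
proof -
  have "aff_length n f = card {p \<in> inversions f. fst p \<in> {1..int n}}"
    unfolding aff_length_def inversions_def by (rule arg_cong[where f = card]) auto
  also have "\<dots> = card {p \<in> inversions f. u p \<in> {1..int n}}"
    using f by (intro card_orbit_representatives assms) (auto simp: inversions_def affine_perm_def)
  finally show ?thesis .
qed

lemma affine_perm_displacement_bounded:
  assumes "n \<ge> 1" "affine_perm n f"
  shows "\<exists>M. \<forall>a. \<bar>f a - a\<bar> \<le> M"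
proof (intro exI allI)
  fix a
  have "f a - a = f (a mod int n) - a mod int n"
    using affine_perm_add_mult[OF assms(2), of "a mod int n" "a div int n"]
    by (simp add: algebra_simps)
  moreover have "a mod int n \<in> {0..<int n}" using assms(1) by simp
  then have "\<bar>f (a mod int n) - a mod int n\<bar> \<le> (\<Sum>b\<in>{0..<int n}. \<bar>f b - b\<bar>)"
    by (intro member_le_sum) auto
  ultimately show "\<bar>f a - a\<bar> \<le> (\<Sum>b\<in>{0..<int n}. \<bar>f b - b\<bar>)" by simp
qed

lemma finite_inversions:
  assumes "n \<ge> 1" "affine_perm n f"
  shows "finite {p \<in> inversions f. fst p - c \<in> {1..int n}}"
proof -
  obtain M where M: "\<And>a. \<bar>f a - a\<bar> \<le> M"
    using affine_perm_displacement_bounded[OF assms] by blast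
  have "b \<le> c + int n + 2 * M" if "(a, b) \<in> inversions f" "a - c \<le> int n" for a b
    using that M[of a] M[of b] by (auto simp: inversions_def)
  then have "{p \<in> inversions f. fst p - c \<in> {1..int n}} \<subseteq> {c..c + int n} \<times> {c..c + int n + 2 * M}"
    by (force simp: inversions_def)
  then show ?thesis by (rule finite_subset) simp
qed

text \<open>Applying the reflection to both entries maps the inversions of \<open>f\<close> to
  inversions of the product; only the orbit of \<open>(i, i + 1)\<close> is new.\<close>

lemma aff_length_mult_left_ascent:
  assumes n: "n \<ge> 2" and f: "affine_perm n f" and asc: "f i < f (i + 1)"
  shows "aff_length n (simple_refl n i \<cdot> f) = aff_length n f + 1"
proof -
  let ?s = "simple_refl n i"
  have n1: "n \<ge> 1" using n by simp
  have s: "?s (?s a) = a" "?s i = i + 1" "?s (i + 1) = i" for a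
    using simple_refl_invol[OF n] simple_refl_left[of i n i] simple_refl_right[OF n, of "i + 1" i] by auto
  \<comment> \<open>Both windows start right after \<open>i\<close>, so that
    \<open>(i, i + 1)\<close> represents its orbit in \<open>J\<close>. The reflected first entry in
    \<open>J\<close> makes the map respect the windows.\<close>
  define I where "I = {p \<in> inversions f. fst p - i \<in> {1..int n}}"
  define J where "J = {p \<in> inversions (?s \<cdot> f). ?s (fst p) - i \<in> {1..int n}}"
  have lI: "aff_length n f = card I"
    unfolding I_def by (rule aff_length_eq_card_representatives[OF n1 f]) simp
  have lJ: "aff_length n (?s \<cdot> f) = card J"
    unfolding J_def
    by (rule aff_length_eq_card_representatives[OF n1 affine_perm_mult[OF affine_perm_simple_refl[OF n] f]])
      (simp add: simple_refl_periodic)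
  have "J = insert (i, i + 1) (map_prod ?s ?s ` I)"
  proof (intro equalityI subsetI)
    fix p assume "p \<in> J"
    then obtain a b where p: "p = (a, b)" "a < b" "f (?s a) > f (?s b)" "?s a - i \<in> {1..int n}"
      by (cases p) (auto simp: J_def inversions_def aff_mult_def)
    show "p \<in> insert (i, i + 1) (map_prod ?s ?s ` I)"
    proof (cases "?s a < ?s b")
      case True
      then have "(?s a, ?s b) \<in> I" using p by (simp add: I_def inversions_def)
      then have "map_prod ?s ?s (?s a, ?s b) \<in> map_prod ?s ?s ` I" by (rule imageI)
      then show ?thesis using p by (simp add: s)
    next
      case False
      then have b: "b = a + 1" "a mod int n = i mod int n"
        using simple_refl_less_iff[OF n p(2), of i] by auto
      obtain t where t: "a = i + t * int n" using mod_eqE[OF b(2)] .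
      have "t * int n + 1 \<in> {1..int n}" using p(4) simple_refl_left[OF b(2)] t by simp
      then have tn: "0 \<le> t * int n" "t * int n < 1 * int n" by (simp_all only: atLeastAtMost_iff) linarith+
      have "0 \<le> t" using tn(1) n1 by (simp add: zero_le_mult_iff)
      moreover have "t < 1" using tn(2) by (rule mult_right_less_imp_less) simp
      ultimately have "t = 0" by simp
      then show ?thesis using p b t by simp
    qed
  next
    fix p assume "p \<in> insert (i, i + 1) (map_prod ?s ?s ` I)"
    then consider "p = (i, i + 1)" | a b where "p = (?s a, ?s b)" "(a, b) \<in> I" by auto
    then show "p \<in> J"
    proof cases
      case 1
      then show ?thesis using asc n1 by (simp add: J_def inversions_def aff_mult_def s)
    next
      case 2
      then have ab: "a < b" "f a > f b" "a - i \<in> {1..int n}" by (auto simp: I_def inversions_def)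
      have "\<not> (b = a + 1 \<and> a mod int n = i mod int n)"
        using ab(2) asc affine_perm_less_cong[OF f, of a i] by auto
      then have "?s a < ?s b" using simple_refl_less_iff[OF n ab(1), of i] by simp
      then show ?thesis using 2 ab by (simp add: J_def inversions_def aff_mult_def s)
    qed
  qed
  moreover have "inj_on (map_prod ?s ?s) I"
    by (rule inj_on_inverseI[where g = "map_prod ?s ?s"]) (auto simp: s)
  moreover have "(i, i + 1) \<notin> map_prod ?s ?s ` I"
  proof
    assume "(i, i + 1) \<in> map_prod ?s ?s ` I"
    then obtain a b where "(a, b) \<in> I" "?s a = i" "?s b = i + 1" by auto
    then have "(i + 1, i) \<in> I" using s by metis
    then show False by (simp add: I_def inversions_def)
  qed
  moreover have "finite I" unfolding I_def by (rule finite_inversions[OF n1 f])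
  ultimately show ?thesis by (simp add: lI lJ card_image)
qed

lemma aff_length_mult_left:
  assumes n: "n \<ge> 2" and f: "affine_perm n f"
  shows "if f i < f (i + 1) then aff_length n (simple_refl n i \<cdot> f) = aff_length n f + 1
         else aff_length n f = aff_length n (simple_refl n i \<cdot> f) + 1"
proof (cases "f i < f (i + 1)")
  case False
  let ?s = "simple_refl n i"
  have "f i \<noteq> f (i + 1)" using f by (auto simp: affine_perm_def bij_def inj_eq)
  then have "(?s \<cdot> f) i < (?s \<cdot> f) (i + 1)"
    using False simple_refl_left[of i n i] simple_refl_right[OF n, of "i + 1" i] by (simp add: aff_mult_def)
  from aff_length_mult_left_ascent[OF n affine_perm_mult[OF affine_perm_simple_refl[OF n] f] this]
  show ?thesis using False simple_refl_mult_self(1)[OF n] by simp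
qed (use aff_length_mult_left_ascent[OF n f] in simp)

lemma aff_length_inv:
  assumes n: "n \<ge> 1" and f: "affine_perm n f"
  shows "aff_length n (inv f) = aff_length n f"
proof -
  have b: "bij f" using f by (simp add: affine_perm_def)
  then have i: "inv f (f a) = a" "f (inv f a) = a" for a by (simp_all add: bij_is_inj bij_is_surj surj_f_inv_f)
  let ?A = "{p \<in> inversions f. f (snd p) \<in> {1..int n}}"
  let ?B = "{p \<in> inversions (inv f). fst p \<in> {1..int n}}"
  have "bij_betw (\<lambda>(a, b). (f b, f a)) ?A ?B"
    by (rule bij_betw_byWitness[where f' = "\<lambda>(a, b). (inv f b, inv f a)"])
      (auto simp: inversions_def i)
  moreover have "aff_length n f = card ?A"
    using f by (intro aff_length_eq_card_representatives n) (auto simp: affine_perm_def)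
  moreover have "aff_length n (inv f) = card ?B"
    by (intro aff_length_eq_card_representatives n affine_perm_inv f) auto
  ultimately show ?thesis by (simp add: bij_betw_same_card)
qed

lemma aff_length_mult_right:
  assumes n: "n \<ge> 2" and f: "affine_perm n f"
  shows "if inv f i < inv f (i + 1) then aff_length n (f \<cdot> simple_refl n i) = aff_length n f + 1
         else aff_length n f = aff_length n (f \<cdot> simple_refl n i) + 1"
proof -
  have n1: "n \<ge> 1" using n by simp
  have "aff_length n (f \<cdot> simple_refl n i) = aff_length n (simple_refl n i \<cdot> inv f)"
    using aff_length_inv[OF n1 affine_perm_mult[OF f affine_perm_simple_refl[OF n]], of i]
      inv_aff_mult[OF f affine_perm_simple_refl[OF n], of i] inv_simple_refl[OF n] by simp
  then show ?thesis
    using aff_length_mult_left[OF n affine_perm_inv[OF f], of i] aff_length_inv[OF n1 f] by presburger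
qed

section \<open>Regions between two lattice paths\<close>

text \<open>A periodic path is encoded by the function sending \<open>d\<close> to the \<open>x\<close>-coordinate of its vertex on
  the antidiagonal \<open>x + y = d\<close>; its edge \<open>d\<close> joins the vertices \<open>d - 1\<close> and \<open>d\<close>. In this encoding
  a path weakly to the north-west of another one is pointwise smaller.\<close>

definition lattice_fun :: "nat \<Rightarrow> nat \<Rightarrow> (int \<Rightarrow> int) \<Rightarrow> bool" where
  "lattice_fun n k X \<longleftrightarrow> (\<forall>d. X d = X (d - 1) \<or> X d = X (d - 1) + 1)
     \<and> (\<forall>d. X (d + int n) = X d + (int n - int k))"

definition path_edge :: "(int \<Rightarrow> int) \<Rightarrow> int \<Rightarrow> edge" where
  "path_edge X d =
     (if X d = X (d - 1) then VEdge (X d) (d - 1 - X d) else HEdge (X (d - 1)) (d - 1 - X (d - 1)))"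

text \<open>The corners \<open>(x, y + 1)\<close> and \<open>(x + 1, y)\<close> of the box lie on
  the antidiagonal \<open>x + y + 1\<close>. The box is between the paths iff \<open>Q\<close> meets
  this antidiagonal at or before the first point and \<open>P\<close> at or after the
  second.\<close>

definition region :: "(int \<Rightarrow> int) \<Rightarrow> (int \<Rightarrow> int) \<Rightarrow> box set" where
  "region Q P = {(x, y). Q (x + y + 1) \<le> x \<and> x < P (x + y + 1)}"

definition nested :: "nat \<Rightarrow> nat \<Rightarrow> (int \<Rightarrow> int) \<Rightarrow> (int \<Rightarrow> int) \<Rightarrow> bool" where
  "nested n k Q P \<longleftrightarrow> lattice_fun n k Q \<and> lattice_fun n k P \<and> (\<forall>d. Q d \<le> P d)"

definition corner :: "(int \<Rightarrow> int) \<Rightarrow> int \<Rightarrow> bool" where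
  "corner P j \<longleftrightarrow> P j = P (j - 1) + 1 \<and> P (j + 1) = P j"

definition cut :: "nat \<Rightarrow> int \<Rightarrow> (int \<Rightarrow> int) \<Rightarrow> int \<Rightarrow> int" where
  "cut n j P d = P d - (if d mod int n = j mod int n then 1 else 0)"

text \<open>For nested paths, the number of boxes of the region in one period: each antidiagonal
  \<open>d\<close> contributes those with \<open>Q d \<le> x < P d\<close>. It is the measure of the
  inductions.\<close>

definition area :: "nat \<Rightarrow> (int \<Rightarrow> int) \<Rightarrow> (int \<Rightarrow> int) \<Rightarrow> nat" where
  "area n Q P = nat (\<Sum>d\<in>{0..<int n}. P d - Q d)"

lemma lattice_fun_step: "lattice_fun n k X \<Longrightarrow> X d = X (d - 1) \<or> X d = X (d - 1) + 1"
  by (simp add: lattice_fun_def)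

lemma lattice_fun_add_mult:
  assumes "lattice_fun n k X" shows "X (a + t * int n) = X a + t * (int n - int k)"
proof (induction t rule: int_induct[where k = 0])
  case (step1 t)
  have "X (a + t * int n + int n) = X (a + t * int n) + (int n - int k)"
    using assms by (simp add: lattice_fun_def)
  then show ?case using step1 by (simp add: algebra_simps)
next
  case (step2 t)
  have "X (a + (t - 1) * int n + int n) = X (a + (t - 1) * int n) + (int n - int k)"
    using assms by (simp add: lattice_fun_def)
  then show ?case using step2 by (simp add: algebra_simps)
qed simp

lemma lattice_fun_diff_cong:
  assumes X: "lattice_fun n k X" and ij: "i mod int n = j mod int n"
  shows "X (i + c) - X i = X (j + c) - X j"
proof -
  obtain t where "i = j + t * int n" using mod_eqE[OF ij] .
  then show ?thesis
    using lattice_fun_add_mult[OF X, of j t] lattice_fun_add_mult[OF X, of "j + c" t]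
    by (simp add: algebra_simps)
qed

lemma lattice_fun_bounds:
  assumes "lattice_fun n k X" "a \<le> b"
  shows "X a \<le> X b" "X b \<le> X a + (b - a)"
proof -
  have "X a \<le> X b \<and> X b \<le> X a + (b - a)"
    using assms(2)
  proof (induction b rule: int_ge_induct)
    case (step b)
    then show ?case using lattice_fun_step[OF assms(1), of "b + 1"] by auto
  qed simp
  then show "X a \<le> X b" "X b \<le> X a + (b - a)" by auto
qed

lemma corner_cong:
  assumes X: "lattice_fun n k X" and ij: "i mod int n = j mod int n"
  shows "corner X i \<longleftrightarrow> corner X j"
  using lattice_fun_diff_cong[OF assms, of "-1"] lattice_fun_diff_cong[OF assms, of 1]
  by (auto simp: corner_def)

lemma less_cong:
  assumes "lattice_fun n k Q" "lattice_fun n k P" and ij: "i mod int n = j mod int n"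
  shows "Q i < P i \<longleftrightarrow> Q j < P j"
proof -
  obtain t where "i = j + t * int n" using mod_eqE[OF ij] .
  then show ?thesis
    using lattice_fun_add_mult[OF assms(1), of j t] lattice_fun_add_mult[OF assms(2), of j t] by simp
qed

lemma lattice_fun_cut:
  assumes n: "n \<ge> 2" and P: "lattice_fun n k P" and j: "corner P j"
  shows "lattice_fun n k (cut n j P)"
  unfolding lattice_fun_def
proof (intro conjI allI)
  fix d
  have ne: "\<not> (d mod int n = j mod int n \<and> (d - 1) mod int n = j mod int n)"
    using succ_mod_neq[OF n, of "d - 1"] by auto
  show "cut n j P d = cut n j P (d - 1) \<or> cut n j P d = cut n j P (d - 1) + 1"
    using ne corner_cong[OF P, of d j] corner_cong[OF P, of "d - 1" j] j lattice_fun_step[OF P, of d]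
    by (auto simp: cut_def corner_def)
  show "cut n j P (d + int n) = cut n j P d + (int n - int k)"
    using P by (simp add: cut_def lattice_fun_def)
qed

lemma nested_cut:
  assumes n: "n \<ge> 2" and QP: "nested n k Q P" and j: "corner P j" "Q j < P j"
  shows "nested n k Q (cut n j P)"
proof -
  have "Q d \<le> cut n j P d" for d
    using QP less_cong[of n k Q P d j] j(2) by (auto simp: cut_def nested_def)
  then show ?thesis using QP lattice_fun_cut[OF n _ j(1)] by (simp add: nested_def)
qed

lemma area_cut:
  assumes n: "n \<ge> 2" and QP: "nested n k Q P" and j: "corner P j" "Q j < P j"
  shows "area n Q (cut n j P) < area n Q P"
proof -
  let ?A = "{0..<int n}"
  have "(\<Sum>d\<in>?A. cut n j P d - Q d) < (\<Sum>d\<in>?A. P d - Q d)"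
  proof (rule sum_strict_mono_ex1)
    show "\<exists>a\<in>?A. cut n j P a - Q a < P a - Q a"
      using n by (intro bexI[of _ "j mod int n"]) (auto simp: cut_def)
  qed (auto simp: cut_def)
  moreover have "0 \<le> (\<Sum>d\<in>?A. cut n j P d - Q d)"
    using nested_cut[OF assms] by (intro sum_nonneg) (simp add: nested_def)
  ultimately show ?thesis by (simp add: area_def)
qed

text \<open>Among the diagonals on which the paths differ, take one on which the linear function
  \<open>n * x - (n - k) * d\<close>, which is constant along the direction of periodicity, is maximal on \<open>P\<close>.\<close>

lemma corner_exists:
  assumes QP: "nested n k Q P" and k: "0 < k" "k < n" and neq: "Q \<noteq> P"
  obtains j where "corner P j" "Q j < P j"
proof -
  have Q: "lattice_fun n k Q" and P: "lattice_fun n k P" and le: "\<And>d. Q d \<le> P d"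
    using QP by (auto simp: nested_def)
  define \<phi> where "\<phi> d = int n * P d - (int n - int k) * d" for d
  define A where "A = {d \<in> {0..<int n}. Q d < P d}"
  have red: "d mod int n \<in> A \<and> \<phi> (d mod int n) = \<phi> d" if "Q d < P d" for d
  proof -
    have "(d mod int n) mod int n = d mod int n" by simp
    then obtain t where t: "d mod int n = d + t * int n" by (rule mod_eqE)
    have "\<phi> (d + t * int n) = \<phi> d"
      unfolding \<phi>_def lattice_fun_add_mult[OF P] by (simp add: algebra_simps)
    then have "\<phi> (d mod int n) = \<phi> d" unfolding t .
    then show ?thesis using that less_cong[OF Q P, of "d mod int n" d] k by (simp add: A_def)
  qed
  have "finite A" unfolding A_def by (rule finite_subset[of _ "{0..<int n}"]) auto
  then have fin: "finite (\<phi> ` A)" by simp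
  obtain d where "Q d \<noteq> P d" using neq by blast
  then have "A \<noteq> {}" using red[of d] le[of d] by force
  then have "Max (\<phi> ` A) \<in> \<phi> ` A" using fin by (intro Max_in) auto
  then obtain j where j: "j \<in> A" "\<phi> j = Max (\<phi> ` A)" by auto
  have max: "\<phi> d \<le> \<phi> j" if "Q d < P d" for d
    using red[OF that] fin j(2) Max_ge[OF fin] by (metis imageI)
  have Qj: "Q j < P j" using j by (simp add: A_def)
  \<comment> \<open>A vertical step into \<open>j\<close> would make \<open>\<phi>\<close> larger by
    \<open>n - k\<close> at \<open>j - 1\<close>, a horizontal step out of \<open>j\<close> would
    make it larger by \<open>k\<close> at \<open>j + 1\<close>. Both amounts are positive, and the
    paths would still differ there.\<close>
  have c1: "P j = P (j - 1) + 1"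
  proof (rule ccontr)
    assume "P j \<noteq> P (j - 1) + 1"
    then have "P (j - 1) = P j" using lattice_fun_step[OF P, of j] by auto
    then have "Q (j - 1) < P (j - 1)" "\<phi> (j - 1) > \<phi> j"
      using Qj lattice_fun_step[OF Q, of j] k by (auto simp: \<phi>_def algebra_simps)
    then show False using max[of "j - 1"] by simp
  qed
  have c2: "P (j + 1) = P j"
  proof (rule ccontr)
    assume "P (j + 1) \<noteq> P j"
    then have "P (j + 1) = P j + 1" using lattice_fun_step[OF P, of "j + 1"] by auto
    then have "Q (j + 1) < P (j + 1)" "\<phi> (j + 1) > \<phi> j"
      using Qj lattice_fun_step[OF Q, of "j + 1"] k by (auto simp: \<phi>_def algebra_simps)
    then show False using max[of "j + 1"] by simp
  qed
  show thesis using that[OF _ Qj] c1 c2 by (simp add: corner_def)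
qed

lemma path_edge_inject:
  assumes "path_edge X a = path_edge X b" shows "a = b"
  using assms by (auto simp: path_edge_def split: if_splits)

lemma entered_box_path_edge_notin:
  assumes "lattice_fun n k P"
  shows "entered_box (path_edge P d) \<notin> region Q P"
  using lattice_fun_step[OF assms, of d] by (auto simp: path_edge_def region_def)

section \<open>Strands\<close>

primrec trace :: "(box \<Rightarrow> tile option) \<Rightarrow> edge \<Rightarrow> nat \<Rightarrow> edge option" where
  "trace D e 0 = Some e"
| "trace D e (Suc m) =
     (case trace D e m of None \<Rightarrow> None
      | Some e' \<Rightarrow> map_option (\<lambda>t. exit_edge t e') (D (entered_box e')))"

definition visits :: "(box \<Rightarrow> tile option) \<Rightarrow> edge \<Rightarrow> box set" where
  "visits D e = {b \<in> dom D. \<exists>m e'. trace D e m = Some e' \<and> entered_box e' = b}"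

text \<open>Every move to the right or down raises this number by 1, on every strand. So of two
  boxes on a strand the earlier one has the smaller \<open>pot\<close>, whichever strand is
  followed.\<close>

definition pot :: "box \<Rightarrow> int" where
  "pot b = fst b - snd b"

lemma trace_Suc_eq_Some:
  "trace D e (Suc m) = Some e'' \<longleftrightarrow>
     (\<exists>e' t. trace D e m = Some e' \<and> D (entered_box e') = Some t \<and> e'' = exit_edge t e')"
  by (auto split: option.split)

lemma trace_prefix:
  assumes "trace D e m = Some e'" "m' < m"
  shows "\<exists>e''. trace D e m' = Some e'' \<and> entered_box e'' \<in> dom D"
  using assms
proof (induction m arbitrary: e')
  case (Suc m)
  then obtain e1 t where e1: "trace D e m = Some e1" "D (entered_box e1) = Some t"
    using trace_Suc_eq_Some by blast
  then show ?case using Suc by (cases "m' = m") (auto simp: less_Suc_eq)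
qed simp

lemma trace_mono:
  assumes "D \<subseteq>\<^sub>m D'" "trace D e m = Some e'" shows "trace D' e m = Some e'"
  using assms(2)
proof (induction m arbitrary: e')
  case (Suc m)
  then obtain e1 t where "trace D e m = Some e1" "D (entered_box e1) = Some t" "e' = exit_edge t e1"
    unfolding trace_Suc_eq_Some by blast
  then show ?case using Suc.IH assms(1) unfolding trace_Suc_eq_Some by (metis domI map_le_def)
qed simp

lemma pot_exit_edge: "pot (entered_box (exit_edge t e)) = pot (entered_box e) + 1"
  by (cases t; cases e) (auto simp: pot_def)

lemma pot_trace:
  "trace D e m = Some e' \<Longrightarrow> pot (entered_box e') = pot (entered_box e) + int m"
proof (induction m arbitrary: e')
  case (Suc m)
  then show ?case unfolding trace_Suc_eq_Some by (auto simp: pot_exit_edge)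
qed simp

lemma visits_iff:
  assumes "trace D e m = Some e'" "entered_box e' \<notin> dom D"
  shows "b \<in> visits D e \<longleftrightarrow> (\<exists>m'<m. \<exists>e''. trace D e m' = Some e'' \<and> entered_box e'' = b)"
proof
  assume "b \<in> visits D e"
  then obtain m' e'' where *: "trace D e m' = Some e''" "entered_box e'' = b" "b \<in> dom D"
    by (auto simp: visits_def)
  then have "m' \<noteq> m" "\<not> m < m'" using assms trace_prefix[OF *(1), of m] by auto
  then show "\<exists>m'<m. \<exists>e''. trace D e m' = Some e'' \<and> entered_box e'' = b" using * by force
next
  assume "\<exists>m'<m. \<exists>e''. trace D e m' = Some e'' \<and> entered_box e'' = b"
  then show "b \<in> visits D e" using trace_prefix[OF assms(1)] by (fastforce simp: visits_def)
qed

lemma trace_end_unique: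
  assumes "trace D e m = Some a" "entered_box a \<notin> dom D"
    and "trace D e m' = Some b" "entered_box b \<notin> dom D"
  shows "a = b"
proof -
  have "\<not> m < m'" "\<not> m' < m"
    using trace_prefix[OF assms(3), of m] trace_prefix[OF assms(1), of m'] assms by auto
  then have "m = m'" by simp
  then show ?thesis using assms by simp
qed

lemma finite_visits:
  assumes "trace D e m = Some e'" "entered_box e' \<notin> dom D"
  shows "finite (visits D e)"
proof -
  have "visits D e \<subseteq> (\<lambda>m'. entered_box (the (trace D e m'))) ` {..<m}"
    using visits_iff[OF assms] by force
  then show ?thesis by (rule finite_subset) simp
qed

lemma pot_visits_less:
  assumes "trace D e m = Some e'" "entered_box e' \<notin> dom D" "b \<in> visits D e"
  shows "pot b < pot (entered_box e')"
  using assms visits_iff[OF assms(1,2)] pot_trace by fastforce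

lemma visits_extend_same:
  assumes D: "D \<subseteq>\<^sub>m D'" and m: "trace D e m = Some e'" and e': "entered_box e' \<notin> dom D'"
  shows "visits D' e = visits D e"
proof -
  have "entered_box e' \<notin> dom D" using D e' map_le_implies_dom_le by blast
  note v = visits_iff[OF m this] visits_iff[OF trace_mono[OF D m] e']
  have tr: "trace D' e m' = trace D e m'" if "m' < m" for m'
    using trace_prefix[OF m that] trace_mono[OF D] by force
  show ?thesis by (rule set_eqI) (simp add: v, metis tr)
qed

lemma visits_extend_step:
  assumes D: "D \<subseteq>\<^sub>m D'" and m: "trace D e m = Some e'" and e': "entered_box e' \<notin> dom D"
    and t: "D' (entered_box e') = Some t" and e'': "entered_box (exit_edge t e') \<notin> dom D'"
  shows "trace D' e (Suc m) = Some (exit_edge t e')"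
    and "visits D' e = insert (entered_box e') (visits D e)"
proof -
  have m': "trace D' e m = Some e'" using trace_mono[OF D m] .
  show *: "trace D' e (Suc m) = Some (exit_edge t e')" using m' t by simp
  note v = visits_iff[OF m e'] visits_iff[OF * e'']
  have tr: "trace D' e m' = trace D e m'" if "m' < m" for m'
    using trace_prefix[OF m that] trace_mono[OF D] by force
  show "visits D' e = insert (entered_box e') (visits D e)"
    by (rule set_eqI) (simp add: v less_Suc_eq, metis tr m' option.inject)
qed

section \<open>Deograms between two paths\<close>

definition periodic :: "nat \<Rightarrow> nat \<Rightarrow> (box \<Rightarrow> tile option) \<Rightarrow> bool" where
  "periodic n k D \<longleftrightarrow> (\<forall>x y. D (x + (int n - int k), y + int k) = D (x, y))"

definition crossings :: "(int \<Rightarrow> int) \<Rightarrow> (box \<Rightarrow> tile option) \<Rightarrow> int \<Rightarrow> int \<Rightarrow> box set" where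
  "crossings Q D d d' =
     {c \<in> visits D (path_edge Q d) \<inter> visits D (path_edge Q d'). D c = Some Crossing}"

text \<open>The single bound \<open>pot b\<close> replaces the separate numbers of preceding boxes
  on the two strands.\<close>

definition distinguished :: "(int \<Rightarrow> int) \<Rightarrow> (box \<Rightarrow> tile option) \<Rightarrow> bool" where
  "distinguished Q D \<longleftrightarrow> (\<forall>d d' b. d \<noteq> d' \<and> D b = Some Elbow
      \<and> b \<in> visits D (path_edge Q d) \<and> b \<in> visits D (path_edge Q d')
      \<longrightarrow> even (card {c \<in> crossings Q D d d'. pot c < pot b}))"

text \<open>Strands are indexed here by the antidiagonals of the edges through which they enter and leave. For
  the strip of \<open>P\<close> the northern edge labeled \<open>i\<close> lies on antidiagonal \<open>i + k\<close>.\<close>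

definition wired :: "(int \<Rightarrow> int) \<Rightarrow> (int \<Rightarrow> int) \<Rightarrow> (box \<Rightarrow> tile option) \<Rightarrow> (int \<Rightarrow> int) \<Rightarrow> bool" where
  "wired Q P D g \<longleftrightarrow> (\<forall>d. \<exists>m. trace D (path_edge Q d) m = Some (path_edge P (g d)))"

text \<open>An invariant that will be shown for every periodic filling of the regions considered,
  with \<open>g\<close> its strand permutation. It lets the elbow condition be read off from
  \<open>g\<close> alone.\<close>

definition parity :: "(int \<Rightarrow> int) \<Rightarrow> (box \<Rightarrow> tile option) \<Rightarrow> (int \<Rightarrow> int) \<Rightarrow> bool" where
  "parity Q D g \<longleftrightarrow>
     (\<forall>d d'. d \<noteq> d' \<longrightarrow> (even (card (crossings Q D d d')) \<longleftrightarrow> (d < d' \<longleftrightarrow> g d < g d')))"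

definition deograms ::
  "nat \<Rightarrow> nat \<Rightarrow> (int \<Rightarrow> int) \<Rightarrow> (int \<Rightarrow> int) \<Rightarrow> (int \<Rightarrow> int) \<Rightarrow> (box \<Rightarrow> tile option) set" where
  "deograms n k Q P g =
     {D. dom D = region Q P \<and> periodic n k D \<and> wired Q P D g \<and> distinguished Q D}"

text \<open>The vertex \<open>d\<close> is the lower right corner of this box; at a corner of
  \<open>P\<close> the box fits into the bend between a right step and an up step.\<close>

definition corner_box :: "(int \<Rightarrow> int) \<Rightarrow> int \<Rightarrow> box" where
  "corner_box P d = (P d - 1, d - P d)"

definition fill :: "nat \<Rightarrow> int \<Rightarrow> (int \<Rightarrow> int) \<Rightarrow> tile \<Rightarrow> (box \<Rightarrow> tile option) \<Rightarrow> box \<Rightarrow> tile option" where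
  "fill n j P t D b =
     (if \<exists>d. d mod int n = j mod int n \<and> b = corner_box P d then Some t else D b)"

lemma wired_unique:
  assumes "lattice_fun n k P" "dom D = region Q P" "wired Q P D g" "wired Q P D g'"
  shows "g = g'"
proof
  fix d
  obtain m where "trace D (path_edge Q d) m = Some (path_edge P (g d))"
    using assms(3) by (auto simp: wired_def)
  moreover obtain m' where "trace D (path_edge Q d) m' = Some (path_edge P (g' d))"
    using assms(4) by (auto simp: wired_def)
  ultimately have "path_edge P (g d) = path_edge P (g' d)"
    using trace_end_unique entered_box_path_edge_notin[OF assms(1)] assms(2) by metis
  then show "g d = g' d" by (rule path_edge_inject)
qed

lemma distinguishedD:
  assumes "distinguished Q D" "d \<noteq> d'" "D b = Some Elbow"
    "b \<in> visits D (path_edge Q d)" "b \<in> visits D (path_edge Q d')"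
  shows "even (card {c \<in> crossings Q D d d'. pot c < pot b})"
  using assms unfolding distinguished_def by blast

section \<open>Removing one orbit of corner boxes\<close>

locale box_removal =
  fixes n k :: nat and Q P :: "int \<Rightarrow> int" and j :: int
  assumes n: "n \<ge> 2" and QP: "nested n k Q P" and j: "corner P j" "Q j < P j"
begin

abbreviation "s \<equiv> simple_refl n j"
abbreviation "P0 \<equiv> cut n j P"
abbreviation "box \<equiv> corner_box P"

lemma Q: "lattice_fun n k Q" and P: "lattice_fun n k P" and P0: "lattice_fun n k P0"
  using QP lattice_fun_cut[OF n _ j(1)] by (auto simp: nested_def)

lemma at_corner:
  assumes "d mod int n = j mod int n"
  shows "P d = P (d - 1) + 1" "P (d + 1) = P d" "Q d < P d"
    "P0 d = P d - 1" "P0 (d - 1) = P d - 1" "P0 (d + 1) = P d"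
proof -
  show *: "P d = P (d - 1) + 1" "P (d + 1) = P d" "Q d < P d"
    using corner_cong[OF P assms] less_cong[OF Q P assms] j by (auto simp: corner_def)
  have "(d + 1) mod int n \<noteq> j mod int n" "(d - 1) mod int n \<noteq> j mod int n"
    using succ_mod_neq[OF n, of d] succ_mod_neq[OF n, of "d - 1"] assms by auto
  then show "P0 d = P d - 1" "P0 (d - 1) = P d - 1" "P0 (d + 1) = P d"
    using * assms by (auto simp: cut_def)
qed

lemma box_inject: "box a = box b \<longleftrightarrow> a = b"
  by (auto simp: corner_box_def)

lemma box_notin: "d mod int n = j mod int n \<Longrightarrow> box d \<notin> region Q P0"
  using at_corner[of d] by (simp add: region_def corner_box_def)

lemma box_in: "d mod int n = j mod int n \<Longrightarrow> box d \<in> region Q P"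
  using at_corner[of d] by (simp add: region_def corner_box_def)

lemma region_split: "region Q P = region Q P0 \<union> {box d |d. d mod int n = j mod int n}"
proof (intro equalityI subsetI)
  fix b assume "b \<in> region Q P"
  then obtain x y where b: "b = (x, y)" "Q (x + y + 1) \<le> x" "x < P (x + y + 1)"
    by (auto simp: region_def)
  show "b \<in> region Q P0 \<union> {box d |d. d mod int n = j mod int n}"
  proof (cases "x < P0 (x + y + 1)")
    case False
    then have "(x + y + 1) mod int n = j mod int n" "x = P (x + y + 1) - 1"
      using b by (auto simp: cut_def split: if_splits)
    then have "b = box (x + y + 1)" "(x + y + 1) mod int n = j mod int n"
      using b by (auto simp: corner_box_def)
    then show ?thesis by blast
  qed (use b in \<open>auto simp: region_def\<close>)
next
  fix b assume "b \<in> region Q P0 \<union> {box d |d. d mod int n = j mod int n}"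
  then show "b \<in> region Q P" using box_in by (auto simp: region_def cut_def split: if_splits)
qed

text \<open>The cut path goes up along edge \<open>l\<close> and then right along edge
  \<open>l + 1\<close>, the left and the top edge of the corner box; \<open>P\<close> has its bottom
  edge as edge \<open>l\<close> and its right edge as edge \<open>l + 1\<close>. Hence a crossing
  exchanges \<open>l\<close> and \<open>l + 1\<close> and an elbow fixes both.\<close>

lemma left_edge:
  assumes "l mod int n = j mod int n"
  shows "entered_box (path_edge P0 l) = box l"
    "exit_edge t (path_edge P0 l) = path_edge P (if t = Crossing then l + 1 else l)"
  using at_corner[OF assms]
  by (cases t; auto simp: path_edge_def corner_box_def)+

lemma top_edge:
  assumes "l mod int n = j mod int n"
  shows "entered_box (path_edge P0 (l + 1)) = box l"
    "exit_edge t (path_edge P0 (l + 1)) = path_edge P (if t = Crossing then l else l + 1)"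
  using at_corner[OF assms]
  by (cases t; auto simp: path_edge_def corner_box_def)+

lemma other_edge:
  assumes "l mod int n \<noteq> j mod int n" "(l - 1) mod int n \<noteq> j mod int n"
  shows "path_edge P0 l = path_edge P l"
  using assms by (simp add: path_edge_def cut_def)

text \<open>Periodicity puts the same tile into all boxes of the orbit, so a single tile records
  what is cut off.\<close>

lemma restrict_fill:
  assumes "dom D = region Q P" "periodic n k D"
  obtains t where "D = fill n j P t (D |` region Q P0)" "dom (D |` region Q P0) = region Q P0"
    "periodic n k (D |` region Q P0)"
proof -
  obtain t where t: "D (box j) = Some t" using assms(1) box_in[of j] by blast
  have D: "D (box d) = Some t" if d: "d mod int n = j mod int n" for d
  proof -
    obtain u where u: "d = j + u * int n" using mod_eqE[OF d] .
    have "D (box (j + u * int n)) = Some t"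
    proof (induction u rule: int_induct[where k = 0])
      case (step1 u)
      have "box (j + (u + 1) * int n) = (fst (box (j + u * int n)) + (int n - int k), snd (box (j + u * int n)) + int k)"
        unfolding corner_box_def lattice_fun_add_mult[OF P] by (simp add: algebra_simps)
      then show ?case using step1 assms(2) by (simp add: periodic_def)
    next
      case (step2 u)
      have "box (j + u * int n) = (fst (box (j + (u - 1) * int n)) + (int n - int k), snd (box (j + (u - 1) * int n)) + int k)"
        unfolding corner_box_def lattice_fun_add_mult[OF P] by (simp add: algebra_simps)
      then show ?case using step2 assms(2) by (simp add: periodic_def)
    qed (simp add: t)
    then show ?thesis using u by simp
  qed
  show thesis
  proof (rule that[of t])
    show "D = fill n j P t (D |` region Q P0)"
    proof
      fix b
      show "D b = fill n j P t (D |` region Q P0) b"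
      proof (cases "b \<in> region Q P0")
        case True
        then show ?thesis using box_notin by (auto simp: fill_def)
      next
        case False
        then show ?thesis using D region_split assms(1) by (auto simp: fill_def)
      qed
    qed
    show "dom (D |` region Q P0) = region Q P0" using assms(1) region_split by auto
    have "(x + (int n - int k), y + int k) \<in> region Q P0 \<longleftrightarrow> (x, y) \<in> region Q P0" for x y
    proof -
      have "x + (int n - int k) + (y + int k) + 1 = (x + y + 1) + 1 * int n" by simp
      then show ?thesis
        by (simp only: region_def mem_Collect_eq case_prod_conv lattice_fun_add_mult[OF P0] lattice_fun_add_mult[OF Q]) simp
    qed
    then show "periodic n k (D |` region Q P0)" using assms(2) by (simp add: periodic_def restrict_map_def)
  qed
qed

lemma fill_box: "l mod int n = j mod int n \<Longrightarrow> fill n j P t D (box l) = Some t"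
  by (auto simp: fill_def)

lemma fill_other: "b \<in> region Q P0 \<Longrightarrow> fill n j P t D b = D b"
  using box_notin by (auto simp: fill_def)

text \<open>The assumptions on \<open>h\<close> are supplied by \<open>strand_perm_exists\<close>,
  whose induction step in turn uses this context.\<close>

context
  fixes D0 :: "box \<Rightarrow> tile option" and t :: tile and h :: "int \<Rightarrow> int"
  assumes dom0: "dom D0 = region Q P0" and per0: "periodic n k D0"
    and wired0: "wired Q P0 D0 h" and h: "affine_perm n h" and par0: "parity Q D0 h"
begin

abbreviation "D \<equiv> fill n j P t D0"

text \<open>The removed boxes met by strand \<open>d\<close>. The strand can enter one only through
  the edge where it leaves the smaller region, so there is at most one, and it is the last box of
  the strand.\<close>

definition B :: "int \<Rightarrow> box set" where
  "B d = {box l |l. l mod int n = j mod int n \<and> (h d = l \<or> h d = l + 1)}"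

lemma dom_fill: "dom D = region Q P"
  using dom0 region_split by (auto simp: fill_def dom_def)

lemma map_le_fill: "D0 \<subseteq>\<^sub>m D"
  using fill_other dom0 by (simp add: map_le_def)

lemma periodic_fill: "periodic n k D"
proof -
  have *: "(\<exists>d. d mod int n = j mod int n \<and> (x + (int n - int k), y + int k) = box d) \<longleftrightarrow>
       (\<exists>d. d mod int n = j mod int n \<and> (x, y) = box d)" (is "?L \<longleftrightarrow> ?R") for x y
  proof
    assume ?L
    then obtain d where d: "d mod int n = j mod int n" "(x + (int n - int k), y + int k) = box d" by blast
    then have "(d - int n) mod int n = j mod int n" "(x, y) = box (d - int n)"
      using lattice_fun_add_mult[OF P, of d "-1"] by (auto simp: corner_box_def)
    then show ?R by blast
  next
    assume ?R
    then obtain d where d: "d mod int n = j mod int n" "(x, y) = box d" by blast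
    then have "(d + int n) mod int n = j mod int n" "(x + (int n - int k), y + int k) = box (d + int n)"
      using lattice_fun_add_mult[OF P, of d 1] by (auto simp: corner_box_def)
    then show ?L by blast
  qed
  show ?thesis using per0 unfolding periodic_def fill_def * by auto
qed

lemma strand0:
  obtains m where "trace D0 (path_edge Q d) m = Some (path_edge P0 (h d))"
    "entered_box (path_edge P0 (h d)) \<notin> dom D0"
proof -
  have "\<exists>m. trace D0 (path_edge Q d) m = Some (path_edge P0 (h d))"
    using wired0 by (simp add: wired_def)
  then show ?thesis using that entered_box_path_edge_notin[OF P0] dom0 by auto
qed

lemma strand_fill:
  "(\<exists>m. trace D (path_edge Q d) m = Some (path_edge P (if t = Crossing then s (h d) else h d)))
   \<and> visits D (path_edge Q d) = visits D0 (path_edge Q d) \<union> B d"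
proof -
  obtain m where m: "trace D0 (path_edge Q d) m = Some (path_edge P0 (h d))"
    "entered_box (path_edge P0 (h d)) \<notin> dom D0" using strand0 .
  have notin: "entered_box (path_edge P l) \<notin> dom D" for l
    using entered_box_path_edge_notin[OF P] dom_fill by simp
  show ?thesis
    using n
  proof (cases rule: simple_refl_cases[where a = "h d" and i = j])
    case left
    have "(h d - 1) mod int n \<noteq> j mod int n" using succ_mod_neq[OF n, of "h d - 1"] left(1) by auto
    then have B: "B d = {box (h d)}" using left by (auto simp: B_def)
    have t: "D (entered_box (path_edge P0 (h d))) = Some t"
      using left_edge(1)[OF left(1)] fill_box[OF left(1)] by simp
    have x: "exit_edge t (path_edge P0 (h d)) = path_edge P (if t = Crossing then s (h d) else h d)"
      using left_edge(2)[OF left(1)] left(2) by simp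
    then have "entered_box (exit_edge t (path_edge P0 (h d))) \<notin> dom D" using notin by simp
    note step = visits_extend_step[OF map_le_fill m t this]
    show ?thesis
    proof (intro conjI exI)
      show "trace D (path_edge Q d) (Suc m) = Some (path_edge P (if t = Crossing then s (h d) else h d))"
        using step(1) unfolding x .
      show "visits D (path_edge Q d) = visits D0 (path_edge Q d) \<union> B d"
        unfolding step(2) left_edge(1)[OF left(1)] B by simp
    qed
  next
    case right
    then have "h d mod int n \<noteq> j mod int n" using succ_mod_neq[OF n, of "h d - 1"] by auto
    then have B: "B d = {box (h d - 1)}" using right by (auto simp: B_def)
    note top = top_edge[OF right(1), unfolded diff_add_cancel]
    have t: "D (entered_box (path_edge P0 (h d))) = Some t"
      using top(1) fill_box[OF right(1)] by simp
    have x: "exit_edge t (path_edge P0 (h d)) = path_edge P (if t = Crossing then s (h d) else h d)"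
      using top(2)[of t] right(2) by simp
    then have "entered_box (exit_edge t (path_edge P0 (h d))) \<notin> dom D" using notin by simp
    note step = visits_extend_step[OF map_le_fill m t this]
    show ?thesis
    proof (intro conjI exI)
      show "trace D (path_edge Q d) (Suc m) = Some (path_edge P (if t = Crossing then s (h d) else h d))"
        using step(1) unfolding x .
      show "visits D (path_edge Q d) = visits D0 (path_edge Q d) \<union> B d"
        unfolding step(2) top(1) B by simp
    qed
  next
    case other
    then have B: "B d = {}" by (auto simp: B_def)
    have "entered_box (path_edge P0 (h d)) \<notin> dom D" using notin other_edge[OF other(1,2)] by simp
    note same = visits_extend_same[OF map_le_fill m(1) this]
    have "trace D (path_edge Q d) m = Some (path_edge P (if t = Crossing then s (h d) else h d))"
      using trace_mono[OF map_le_fill m(1)] other(3) other_edge[OF other(1,2)] by (simp only: if_cancel)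
    then show ?thesis unfolding same B by blast
  qed
qed

lemma visits_fill: "visits D (path_edge Q d) = visits D0 (path_edge Q d) \<union> B d"
  using strand_fill by blast

lemma wired_fill: "wired Q P D (if t = Crossing then h \<cdot> s else h)"
  using strand_fill by (auto simp: wired_def aff_mult_def)

lemma affine_perm_fill: "affine_perm n (if t = Crossing then h \<cdot> s else h)"
  using h affine_perm_mult affine_perm_simple_refl[OF n] by simp

lemma visits0: "visits D0 e \<subseteq> region Q P0"
  using dom0 by (auto simp: visits_def)

lemma B_notin: "b \<in> B d \<Longrightarrow> b \<notin> region Q P0"
  using box_notin by (auto simp: B_def)

lemma B_fill: "b \<in> B d \<Longrightarrow> D b = Some t"
  using fill_box by (auto simp: B_def)

lemma pot_less_B:
  assumes "c \<in> visits D0 (path_edge Q d)" "b \<in> B d" shows "pot c < pot b"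
proof -
  obtain m where m: "trace D0 (path_edge Q d) m = Some (path_edge P0 (h d))"
    "entered_box (path_edge P0 (h d)) \<notin> dom D0" using strand0 .
  have "entered_box (path_edge P0 (h d)) = b"
    using assms(2) left_edge(1) top_edge(1) by (auto simp: B_def)
  then show ?thesis using pot_visits_less[OF m assms(1)] by simp
qed

lemma crossings_fill:
  "crossings Q D d d' = crossings Q D0 d d' \<union> (if t = Crossing then B d \<inter> B d' else {})"
proof -
  have "D b = D0 b" if "b \<in> visits D0 e" for b e using visits0 fill_other that by blast
  moreover have "b \<notin> visits D0 e" if "b \<in> B d" for b e d using that B_notin visits0 by blast
  ultimately show ?thesis using B_fill by (auto simp: crossings_def visits_fill)
qed

lemma finite_crossings0: "finite (crossings Q D0 d d')"
proof -
  obtain m where "trace D0 (path_edge Q d) m = Some (path_edge P0 (h d))"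
    "entered_box (path_edge P0 (h d)) \<notin> dom D0" using strand0 .
  then have "finite (visits D0 (path_edge Q d))" by (rule finite_visits)
  then show ?thesis by (simp add: crossings_def)
qed

lemma h_inject: "h d = h d' \<longleftrightarrow> d = d'"
  using h by (auto simp: affine_perm_def bij_def inj_eq)

lemma B_Int:
  assumes "d \<noteq> d'"
  shows "B d \<inter> B d' = (if h d' = h d + 1 \<and> h d mod int n = j mod int n then {box (h d)}
     else if h d = h d' + 1 \<and> h d' mod int n = j mod int n then {box (h d')} else {})"
proof -
  have ne: "\<not> (l mod int n = j mod int n \<and> (l + 1) mod int n = j mod int n)" for l
    using succ_mod_neq[OF n, of l] by auto
  show ?thesis using assms h_inject[of d d'] ne by (auto simp: B_def box_inject)
qed

text \<open>New crossings add one common crossing to exactly those pairs of strands that arrive at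
  the left and the top edge of the same box, and these are the pairs whose order the reflection
  reverses.\<close>

lemma parity_fill: "parity Q D (if t = Crossing then h \<cdot> s else h)"
  unfolding parity_def
proof (intro allI impI)
  fix d d' :: int assume dd': "d \<noteq> d'"
  have par: "even (card (crossings Q D0 d d')) \<longleftrightarrow> (d < d' \<longleftrightarrow> h d < h d')"
    using par0 dd' by (simp add: parity_def)
  show "even (card (crossings Q D d d')) \<longleftrightarrow>
      (d < d' \<longleftrightarrow> (if t = Crossing then h \<cdot> s else h) d < (if t = Crossing then h \<cdot> s else h) d')"
  proof (cases "t = Crossing")
    case False
    then show ?thesis using par crossings_fill[of d d'] by simp
  next
    case True
    have disj: "crossings Q D0 d d' \<inter> (B d \<inter> B d') = {}"
      using visits0 B_notin unfolding crossings_def by blast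
    have "finite (B d \<inter> B d')" by (simp add: B_Int[OF dd'])
    then have card: "card (crossings Q D d d') = card (crossings Q D0 d d') + card (B d \<inter> B d')"
      using True disj finite_crossings0[of d d'] crossings_fill[of d d'] by (simp add: card_Un_disjoint)
    have hne: "h d \<noteq> h d'" using dd' h_inject by blast
    show ?thesis
    proof (cases "h d < h d'")
      case lt: True
      show ?thesis
        unfolding card using True par lt simple_refl_less_iff[OF n lt, of j] B_Int[OF dd']
        by (simp add: aff_mult_def)
    next
      case False
      then have lt: "h d' < h d" using hne by simp
      have "s (h d) \<noteq> s (h d')" using hne simple_refl_invol[OF n] by metis
      then have "s (h d) < s (h d') \<longleftrightarrow> \<not> s (h d') < s (h d)" by auto
      then show ?thesis
        unfolding card using True par lt simple_refl_less_iff[OF n lt, of j] B_Int[OF dd']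
        by (auto simp: aff_mult_def)
    qed
  qed
qed

text \<open>New boxes come last on their strands, so an old elbow sees the same crossings as before.
  At a new elbow all crossings of its two strands count, and by \<open>parity\<close> their number
  is even iff the strands arriving at \<open>j\<close> and \<open>j + 1\<close> started in this
  order.\<close>

lemma distinguished_fill:
  "distinguished Q D \<longleftrightarrow> distinguished Q D0 \<and> (t = Elbow \<longrightarrow> inv h j < inv h (j + 1))"
proof -
  have old: "{c \<in> crossings Q D d d'. pot c < pot b} = {c \<in> crossings Q D0 d d'. pot c < pot b}"
    if "b \<in> visits D0 (path_edge Q d)" for b d d'
    using pot_less_B[OF that] crossings_fill[of d d'] by (auto dest: less_asym)
  have new: "{c \<in> crossings Q D d d'. pot c < pot b} = crossings Q D0 d d'"
    if "b \<in> B d" "t = Elbow" for b d d'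
  proof -
    have "crossings Q D d d' = crossings Q D0 d d'" using crossings_fill[of d d'] that(2) by simp
    then show ?thesis using pot_less_B[OF _ that(1)] by (auto simp: crossings_def)
  qed
  have hh: "h (inv h a) = a" for a using h by (simp add: affine_perm_def bij_is_surj surj_f_inv_f)
  have inv_h: "inv h (h a) = a" for a using h by (simp add: affine_perm_def bij_is_inj)
  show ?thesis
  proof (intro iffI conjI impI)
    assume dist: "distinguished Q D"
    show "distinguished Q D0" unfolding distinguished_def
    proof (intro allI impI, elim conjE)
      fix d d' b assume *: "d \<noteq> d'" "D0 b = Some Elbow" "b \<in> visits D0 (path_edge Q d)"
        "b \<in> visits D0 (path_edge Q d')"
      then have "b \<in> region Q P0" using visits0 by blast
      then have "D b = Some Elbow" using *(2) fill_other by simp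
      then have "even (card {c \<in> crossings Q D d d'. pot c < pot b})"
        using distinguishedD[OF dist *(1)] *(3,4) visits_fill by simp
      then show "even (card {c \<in> crossings Q D0 d d'. pot c < pot b})" using old[OF *(3)] by simp
    qed
    assume t: "t = Elbow"
    let ?d = "inv h j" and ?d' = "inv h (j + 1)"
    have "box j \<in> B ?d" "box j \<in> B ?d'" by (auto simp: B_def hh)
    moreover have ne: "?d \<noteq> ?d'" using hh by (metis add_cancel_right_right zero_neq_one)
    moreover have "D (box j) = Some Elbow" using fill_box t by simp
    ultimately have "even (card {c \<in> crossings Q D ?d ?d'. pot c < pot (box j)})"
      using distinguishedD[OF dist ne] visits_fill by simp
    then have "even (card (crossings Q D0 ?d ?d'))" using new \<open>box j \<in> B ?d\<close> t by simp
    then show "?d < ?d'" using par0 ne by (simp add: parity_def hh)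
  next
    assume R: "distinguished Q D0 \<and> (t = Elbow \<longrightarrow> inv h j < inv h (j + 1))"
    show "distinguished Q D" unfolding distinguished_def
    proof (intro allI impI, elim conjE)
      fix d d' b assume *: "d \<noteq> d'" "D b = Some Elbow" "b \<in> visits D (path_edge Q d)"
        "b \<in> visits D (path_edge Q d')"
      show "even (card {c \<in> crossings Q D d d'. pot c < pot b})"
      proof (cases "b \<in> B d")
        case False
        then have b: "b \<in> visits D0 (path_edge Q d)" using * visits_fill by blast
        then have bR: "b \<in> region Q P0" using visits0 by blast
        then have "b \<notin> B d'" using B_notin by blast
        then have "b \<in> visits D0 (path_edge Q d')" using *(4) visits_fill by blast
        moreover have "D0 b = Some Elbow" using *(2) fill_other[OF bR] by simp
        ultimately show ?thesis using distinguishedD[OF conjunct1[OF R] *(1) _ b] old[OF b] by simp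
      next
        case True
        then have t: "t = Elbow" using B_fill[OF True] *(2) by simp
        have "b \<notin> visits D0 e" for e using True B_notin visits0 by blast
        then have "b \<in> B d \<inter> B d'" using True * visits_fill by blast
        then obtain l where l: "l mod int n = j mod int n" "h d = l \<and> h d' = l + 1 \<or> h d' = l \<and> h d = l + 1"
          by (auto simp: B_Int[OF *(1)] split: if_splits)
        have "inv h l < inv h (l + 1)"
          using affine_perm_less_cong[OF affine_perm_inv[OF h] l(1)] R t by simp
        then have "d < d' \<longleftrightarrow> h d < h d'" using l(2) inv_h by auto (metis less_asym inv_h)+
        then show ?thesis using par0 *(1) new[OF True t] by (simp add: parity_def)
      qed
    qed
  qed
qed

end

end

lemma box_removalI:
  "n \<ge> 2 \<Longrightarrow> nested n k Q P \<Longrightarrow> corner P j \<Longrightarrow> Q j < P j \<Longrightarrow> box_removal n k Q P j"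
  by unfold_locales

text \<open>For \<open>k = 0\<close> or \<open>k = n\<close> there are no corners and the induction
  could not start from a larger region; the alternative \<open>Q = P\<close> covers the empty strips
  of these cases.\<close>

lemma nested_induct [consumes 3, case_names base step]:
  assumes n: "n \<ge> 2" and QP: "nested n k Q P" and k: "Q = P \<or> 0 < k \<and> k < n"
    and base: "nested n k Q Q \<Longrightarrow> R Q"
    and step: "\<And>P j. box_removal n k Q P j \<Longrightarrow> R (cut n j P) \<Longrightarrow> R P"
  shows "R P"
  using QP k
proof (induction P rule: measure_induct_rule[of "area n Q"])
  case (less P)
  show ?case
  proof (cases "Q = P")
    case True
    then show ?thesis using base less.prems by simp
  next
    case False
    then obtain j where j: "corner P j" "Q j < P j"
      using corner_exists less.prems by blast
    have "R (cut n j P)"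
      using less.IH[OF area_cut[OF n less.prems(1) j] nested_cut[OF n less.prems(1) j]] less.prems(2) False
      by blast
    then show ?thesis using step box_removalI[OF n less.prems(1) j] by blast
  qed
qed

lemma region_empty: "region Q Q = {}"
  by (auto simp: region_def)

text \<open>That strands terminate needs no argument of its own: filling one orbit of boxes prolongs
  each strand by at most one box.\<close>

lemma strand_perm_exists:
  assumes "n \<ge> 2" "nested n k Q P" "Q = P \<or> 0 < k \<and> k < n"
    and "dom D = region Q P" "periodic n k D"
  shows "\<exists>h. affine_perm n h \<and> wired Q P D h \<and> parity Q D h"
  using assms
proof (induction P arbitrary: D rule: nested_induct)
  case base
  then have "D = Map.empty" by (simp add: region_empty)
  moreover have "affine_perm n id" by (simp add: affine_perm_def)
  moreover have "wired Q Q Map.empty id" by (auto simp: wired_def intro: exI[of _ 0])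
  moreover have "parity Q Map.empty id" by (simp add: parity_def crossings_def visits_def)
  ultimately show ?case by blast
next
  case (step P j)
  interpret box_removal n k Q P j by fact
  let ?D0 = "D |` region Q P0"
  obtain t where t: "D = fill n j P t ?D0" and D0: "dom ?D0 = region Q P0" "periodic n k ?D0"
    using restrict_fill[OF step.prems] .
  obtain h where h: "wired Q P0 ?D0 h" "affine_perm n h" "parity Q ?D0 h"
    using step.IH[OF D0] by blast
  show ?case
    using affine_perm_fill[OF D0 h, of t] wired_fill[OF D0 h, of t] parity_fill[OF D0 h, of t] t by metis
qed

section \<open>Counting vectors and how they change with the region\<close>

definition count :: "nat \<Rightarrow> nat \<Rightarrow> (int \<Rightarrow> int) \<Rightarrow> (int \<Rightarrow> int) \<Rightarrow> (int \<Rightarrow> int) \<Rightarrow> nat" where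
  "count n k Q P g = (if affine_perm n g then card (deograms n k Q P g) else 0)"

context box_removal
begin

context
  assumes k: "0 < k" "k < n"
begin

lemma deograms_removal:
  assumes g: "affine_perm n g"
  shows "deograms n k Q P g = fill n j P Crossing ` deograms n k Q P0 (g \<cdot> s)
     \<union> (if inv g j < inv g (j + 1) then fill n j P Elbow ` deograms n k Q P0 g else {})"
    (is "_ = ?R")
proof (intro equalityI subsetI)
  have QP0: "nested n k Q P0" using nested_cut[OF n QP j] .
  \<comment> \<open>Supplies \<open>parity\<close> for the filling without the corner boxes, on
    which the elbow criterion rests.\<close>
  have state: "\<exists>h. affine_perm n h \<and> wired Q P0 D0 h \<and> parity Q D0 h"
    if "dom D0 = region Q P0" "periodic n k D0" for D0
    using strand_perm_exists[OF n QP0 _ that] k by blast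
  {
    fix D assume D: "D \<in> deograms n k Q P g"
    let ?D0 = "D |` region Q P0"
    have D': "dom D = region Q P" "periodic n k D" "wired Q P D g" "distinguished Q D"
      using D by (auto simp: deograms_def)
    obtain t where t: "D = fill n j P t ?D0" and D0: "dom ?D0 = region Q P0" "periodic n k ?D0"
      using restrict_fill[OF D'(1,2)] .
    obtain h where h: "wired Q P0 ?D0 h" "affine_perm n h" "parity Q ?D0 h"
      using state[OF D0] by blast
    have "wired Q P D (if t = Crossing then h \<cdot> s else h)"
      using wired_fill[OF D0 h, of t] t by simp
    then have gh: "g = (if t = Crossing then h \<cdot> s else h)"
      using wired_unique[OF P D'(1) D'(3)] by simp
    have dist: "distinguished Q ?D0 \<and> (t = Elbow \<longrightarrow> inv h j < inv h (j + 1))"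
      using distinguished_fill[OF D0 h, of t] t D'(4) by simp
    show "D \<in> ?R"
    proof (cases t)
      case Crossing
      then have "h = g \<cdot> s" using gh simple_refl_mult_self(2)[OF n] by simp
      then have "?D0 \<in> deograms n k Q P0 (g \<cdot> s)"
        using D0 h dist by (simp add: deograms_def)
      then show ?thesis using t Crossing by blast
    next
      case Elbow
      then have "?D0 \<in> deograms n k Q P0 g" "inv g j < inv g (j + 1)"
        using D0 h dist gh by (simp_all add: deograms_def)
      then show ?thesis using t Elbow by auto
    qed
  }
  {
    fix D assume "D \<in> ?R"
    then obtain t D0 h where D: "D = fill n j P t D0" and D0: "D0 \<in> deograms n k Q P0 h"
      and th: "if t = Crossing then h = g \<cdot> s else h = g \<and> inv g j < inv g (j + 1)"
      by (auto split: if_splits)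
    have D0': "dom D0 = region Q P0" "periodic n k D0" "wired Q P0 D0 h" "distinguished Q D0"
      using D0 by (auto simp: deograms_def)
    have h: "affine_perm n h"
      using th g affine_perm_mult[OF g affine_perm_simple_refl[OF n]] by (auto split: if_splits)
    have "parity Q D0 h"
      using state[OF D0'(1,2)] wired_unique[OF P0 D0'(1) D0'(3)] by blast
    note A = D0'(1-3) h this
    have gt: "(if t = Crossing then h \<cdot> s else h) = g"
      using th simple_refl_mult_self(2)[OF n] by (auto split: if_splits)
    have "t = Elbow \<longrightarrow> inv h j < inv h (j + 1)" using th by (auto split: if_splits)
    then show "D \<in> deograms n k Q P g"
      using dom_fill[OF A, of t] periodic_fill[OF A, of t] wired_fill[OF A, of t, unfolded gt]
        distinguished_fill[OF A, of t] D D0'(4) by (simp add: deograms_def)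
  }
qed

lemma inj_on_fill: "inj_on (fill n j P t) (deograms n k Q P0 g)"
proof (rule inj_onI)
  fix D D' assume *: "D \<in> deograms n k Q P0 g" "D' \<in> deograms n k Q P0 g"
    and eq: "fill n j P t D = fill n j P t D'"
  then have dom: "dom D = region Q P0" "dom D' = region Q P0" by (auto simp: deograms_def)
  show "D = D'"
  proof
    fix b
    show "D b = D' b"
    proof (cases "b \<in> region Q P0")
      case True
      then show ?thesis using fill_other[OF True, of t D] fill_other[OF True, of t D'] eq by simp
    next
      case False
      then show ?thesis using dom by (metis domIff)
    qed
  qed
qed

end

end

lemma finite_deograms:
  assumes "n \<ge> 2" "nested n k Q P" "Q = P \<or> 0 < k \<and> k < n" "affine_perm n g"
  shows "finite (deograms n k Q P g)"
proof (cases "Q = P")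
  case True
  have "deograms n k P P g \<subseteq> {Map.empty}" by (auto simp: deograms_def region_empty)
  then show ?thesis using True finite_subset by blast
next
  case False
  then have k: "0 < k" "k < n" using assms(3) by auto
  show ?thesis
    using assms
  proof (induction P arbitrary: g rule: nested_induct)
    case base
    have "deograms n k Q Q g \<subseteq> {Map.empty}" by (auto simp: deograms_def region_empty)
    then show ?case using finite_subset by blast
  next
    case (step P j)
    interpret box_removal n k Q P j by fact
    show ?case
      using step.IH[OF step.prems] step.IH[OF affine_perm_mult[OF step.prems affine_perm_simple_refl[OF n]]]
      by (simp add: deograms_removal[OF k step.prems])
  qed
qed

lemma count_removal:
  assumes "box_removal n k Q P j" "0 < k" "k < n"
  shows "count n k Q P = mult_right n j (count n k Q (cut n j P))"
proof
  fix g
  interpret box_removal n k Q P j by fact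
  show "count n k Q P g = mult_right n j (count n k Q (cut n j P)) g"
  proof (cases "affine_perm n g")
    case g: True
    have gs: "affine_perm n (g \<cdot> s)" using affine_perm_mult[OF g affine_perm_simple_refl[OF n]] .
    have fin: "finite (deograms n k Q P0 h)" if "affine_perm n h" for h
      using finite_deograms[OF n nested_cut[OF n QP j] _ that] assms by blast
    have "fill n j P Crossing D \<noteq> fill n j P Elbow D'" for D D'
      using fill_box[of j Crossing D] fill_box[of j Elbow D'] by auto
    then have "fill n j P Crossing ` A \<inter> fill n j P Elbow ` A' = {}" for A A' by blast
    then show ?thesis
      using g gs fin[OF g] fin[OF gs] inj_on_fill[OF assms(2,3)] deograms_removal[OF assms(2,3) g]
      by (simp add: count_def mult_right_def card_Un_disjoint card_image)
  qed (simp add: count_def mult_right_def)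
qed

lemma count_refl: "count n k Q Q = (\<lambda>g. if g = id then 1 else 0)"
proof
  fix g
  have "wired Q Q Map.empty g \<longleftrightarrow> g = id"
  proof
    assume w: "wired Q Q Map.empty g"
    show "g = id"
    proof
      fix d
      obtain m where m: "trace Map.empty (path_edge Q d) m = Some (path_edge Q (g d))"
        using w by (auto simp: wired_def)
      then have "m = 0" using trace_prefix[OF m, of 0] by auto
      then have "path_edge Q d = path_edge Q (g d)" using m by simp
      then show "g d = id d" using path_edge_inject by fastforce
    qed
  qed (auto simp: wired_def intro: exI[of _ 0])
  then have "deograms n k Q Q g = (if g = id then {Map.empty} else {})"
    by (auto simp: deograms_def region_empty periodic_def distinguished_def)
  then show "count n k Q Q g = (if g = id then 1 else 0)"
    by (cases "g = id") (simp_all add: count_def affine_perm_def)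
qed

text \<open>The seed for passing from right to left operators: on the unit vector at the identity
  both give the indicator of the reflection plus that of the identity, which has an ascent on either
  side.\<close>

lemma mult_left_id:
  assumes n: "n \<ge> 2"
  shows "mult_left n j (\<lambda>g. if g = id then 1 else 0) = mult_right n j (\<lambda>g. if g = id then 1 else 0)"
proof
  fix g :: "int \<Rightarrow> int"
  let ?s = "simple_refl n j"
  have "?s \<cdot> id = ?s" "id \<cdot> ?s = ?s" by (simp_all add: aff_mult_def)
  then have "?s \<cdot> g = id \<longleftrightarrow> g \<cdot> ?s = id"
    using simple_refl_mult_self[OF n] by metis
  then show "mult_left n j (\<lambda>g. if g = id then 1 else 0) g = mult_right n j (\<lambda>g. if g = id then 1 else 0) g"
    by (simp add: mult_left_def mult_right_def)
qed

lemma count_add_north: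
  assumes n: "n \<ge> 2" and QP: "nested n k Q P" and k: "0 < k" "k < n" and crn: "corner Q j"
  shows "count n k (cut n j Q) P = mult_left n j (count n k Q P)"
  using n QP disjI2[OF conjI[OF k]]
proof (induction P rule: nested_induct)
  case base
  \<comment> \<open>Here the region is one orbit of boxes, which can be regarded as added to the
    south of \<open>cut n j Q\<close>; on the unit vector the resulting right operator is the left
    one.\<close>
  have Q: "lattice_fun n k Q" using base by (simp add: nested_def)
  have "nested n k (cut n j Q) Q"
    using Q lattice_fun_cut[OF n Q crn] by (simp add: nested_def cut_def)
  then have "box_removal n k (cut n j Q) Q j"
    using n crn by (intro box_removalI) (simp_all add: cut_def)
  then show ?case
    using count_removal k by (simp add: count_refl mult_left_id[OF n])
next
  case (step P l)
  then interpret box_removal n k Q P l by blast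
  have "nested n k (cut n j Q) P"
    using QP lattice_fun_cut[OF n Q crn] by (auto simp: nested_def cut_def) (smt (verit))
  then have "box_removal n k (cut n j Q) P l"
    using n step.hyps box_removal.j[OF step.hyps] by (intro box_removalI) (auto simp: cut_def)
  then show ?case
    using count_removal[OF _ k] step.hyps step.IH mult_left_right_commute[OF n] by simp
qed

text \<open>Absorbs the translation that occurs when exchanging two steps moves the vertex pinned to
  the origin.\<close>

lemma count_translate:
  assumes n: "n \<ge> 2" and QP: "nested n k Q P" and k: "Q = P \<or> 0 < k \<and> k < n"
  shows "count n k (\<lambda>d. Q d + c) (\<lambda>d. P d + c) = count n k Q P"
proof (cases "Q = P")
  case False
  then have k': "0 < k" "k < n" using k by auto
  show ?thesis
    using assms
  proof (induction P rule: nested_induct)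
    case (step P l)
    then interpret box_removal n k Q P l by blast
    have "box_removal n k (\<lambda>d. Q d + c) (\<lambda>d. P d + c) l"
      using n QP j by (intro box_removalI) (auto simp: nested_def lattice_fun_def corner_def)
    moreover have "cut n l (\<lambda>d. P d + c) = (\<lambda>d. cut n l P d + c)"
      by (simp add: cut_def fun_eq_iff)
    ultimately show ?case using step count_removal k' by simp
  qed (simp add: count_refl)
qed (simp add: count_refl)

text \<open>The relation between \<open>a\<close> and \<open>i\<close> says that the two vertical steps lie in the same two rows on
  both paths. Each pair of boxes in these rows is passed by one braid relation.\<close>

lemma count_commute_up:
  assumes n: "n \<ge> 3" and k: "0 < k" "k < n" and QP: "nested n k Q P"
    and a: "Q a = Q (a - 1)" "Q (a + 1) = Q a"
    and i: "P i = P (i - 1)" "P (i + 1) = P i" and rows: "P i - Q a = i - a"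
  shows "mult_left n a (count n k Q P) = mult_right n i (count n k Q P)"
  using QP i rows
proof (induction P arbitrary: i rule: measure_induct_rule[of "area n Q"])
  case (less P)
  have n2: "n \<ge> 2" using n by simp
  have Q: "lattice_fun n k Q" and P: "lattice_fun n k P" and le: "\<And>d. Q d \<le> P d"
    using less.prems(1) by (auto simp: nested_def)
  \<comment> \<open>Vertex \<open>a\<close> lies between two vertical steps, so it is the only
    vertex of \<open>Q\<close> at its height, and vertex \<open>i\<close> of \<open>P\<close> has
    the same height by \<open>rows\<close>.\<close>
  have level: "i = a" if "Q i = P i"
  proof (rule ccontr)
    assume "i \<noteq> a"
    then consider "i \<ge> a + 1" | "i \<le> a - 1" by linarith
    then show False
    proof cases
      case 1
      then show False using lattice_fun_bounds(2)[OF Q 1] a less.prems that by simp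
    next
      case 2
      then show False using lattice_fun_bounds(2)[OF Q 2] a less.prems that by simp
    qed
  qed
  show ?case
  proof (cases "Q = P")
    case True
    then show ?thesis using level mult_left_id[OF n2] by (simp add: count_refl)
  next
    case False
    then obtain j where j: "corner P j" "Q j < P j" using corner_exists[OF less.prems(1) k] by blast
    note rem = box_removalI[OF n2 less.prems(1) j]
    have ne: "j mod int n \<noteq> l mod int n" if "P l = P (l - 1)" for l
      using j(1) corner_cong[OF P, of j l] that by (auto simp: corner_def)
    have ji: "j mod int n \<noteq> i mod int n" "j mod int n \<noteq> (i + 1) mod int n"
      using ne[of i] ne[of "i + 1"] less.prems by auto
    show ?thesis
    proof (cases "j mod int n = (i - 1) mod int n")
      \<comment> \<open>The corner is none of \<open>i - 1\<close>, \<open>i\<close>,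
        \<open>i + 1\<close> modulo \<open>n\<close>, so its reflection commutes with that of
        \<open>i\<close>.\<close>
      case False
      let ?P = "cut n j P"
      have "?P i = P i" "?P (i - 1) = P (i - 1)" "?P (i + 1) = P (i + 1)"
        using ji False by (auto simp: cut_def)
      then have "mult_left n a (count n k Q ?P) = mult_right n i (count n k Q ?P)"
        using less.IH[OF area_cut[OF n2 less.prems(1) j] nested_cut[OF n2 less.prems(1) j], of i] less.prems
        by simp
      moreover have "i mod int n \<noteq> (j + 1) mod int n"
        using False mod_eq_add_iff[of "i - 1" 1 "int n" j] by auto
      then have "mult_right n i (mult_right n j c) = mult_right n j (mult_right n i c)" for c
        using ji by (intro mult_right_commute[OF n2]) auto
      ultimately show ?thesis
        by (simp add: count_removal[OF rem k] mult_left_right_commute[OF n2])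
    next
      case True
      \<comment> \<open>Steps \<open>i - 1\<close>, \<open>i\<close>, \<open>i + 1\<close> are
        right, up, up. Removing the boxes at \<open>i - 1\<close> and then at \<open>i\<close> makes
        them up, up, right, so the vertical pair now belongs to \<open>i - 1\<close>; the braid
        relation turns the reflection of \<open>i - 1\<close> back into that of
        \<open>i\<close>.\<close>
      have c1: "corner P (i - 1)" "Q (i - 1) < P (i - 1)"
        using corner_cong[OF P True] less_cong[OF Q P True] j by auto
      note rem1 = box_removalI[OF n2 less.prems(1) c1]
      define P1 where "P1 = cut n (i - 1) P"
      have N1: "nested n k Q P1" unfolding P1_def by (rule nested_cut[OF n2 less.prems(1) c1])
      have small: "\<not> int n dvd 1" "\<not> int n dvd 2"
        using n zdvd_imp_le[of "int n" 2] by auto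
      then have mods: "(i - 1) mod int n \<noteq> i mod int n" "(i - 2) mod int n \<noteq> (i - 1) mod int n"
        "(i + 1) mod int n \<noteq> (i - 1) mod int n" "(i - 2) mod int n \<noteq> i mod int n"
        by (auto simp: mod_eq_dvd_iff dvd_diff_commute)
      have P1: "P1 i = P i" "P1 (i + 1) = P i" "P1 (i - 1) = P i - 1" "P1 (i - 2) = P i - 1"
        using mods less.prems c1 by (auto simp: P1_def cut_def corner_def)
      \<comment> \<open>If the paths touched at \<open>i\<close>, then \<open>i = a\<close>, and as
        both arrive there vertically they would also touch at \<open>i - 1\<close>.\<close>
      have "Q i < P i"
        using level le[of i] c1(2) less.prems a by fastforce
      then have c2: "corner P1 i" "Q i < P1 i" by (simp_all add: corner_def P1)
      note rem2 = box_removalI[OF n2 N1 c2]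
      define P2 where "P2 = cut n i P1"
      have N2: "nested n k Q P2" unfolding P2_def by (rule nested_cut[OF n2 N1 c2])
      have P2: "P2 i = P i - 1" "P2 (i - 1) = P i - 1" "P2 (i - 2) = P i - 1"
        using mods by (auto simp: P2_def cut_def P1)
      have "area n Q P2 < area n Q P"
        using area_cut[OF n2 less.prems(1) c1] area_cut[OF n2 N1 c2] by (simp add: P1_def P2_def)
      then have IH: "mult_left n a (count n k Q P2) = mult_right n (i - 1) (count n k Q P2)"
        using less.IH[OF _ N2, of "i - 1"] P2 less.prems by simp
      have "count n k Q P = mult_right n (i - 1) (mult_right n i (count n k Q P2))"
        using count_removal[OF rem1 k] count_removal[OF rem2 k] by (simp add: P1_def P2_def)
      then show ?thesis
        using IH mult_right_braid[OF n, of "i - 1"] by (simp add: mult_left_right_commute[OF n2])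
    qed
  qed
qed

text \<open>The argument of \<open>count_commute_up\<close> with columns for rows:
  \<open>cols\<close> puts both horizontal pairs into the same two columns. The obstructing corner
  is now at \<open>i + 1\<close>, where right, right, up becomes up, right, right.\<close>

lemma count_commute_right:
  assumes n: "n \<ge> 3" and k: "0 < k" "k < n" and QP: "nested n k Q P"
    and a: "Q a = Q (a - 1) + 1" "Q (a + 1) = Q a + 1"
    and i: "P i = P (i - 1) + 1" "P (i + 1) = P i + 1" and cols: "P i = Q a"
  shows "mult_left n a (count n k Q P) = mult_right n i (count n k Q P)"
  using QP i cols
proof (induction P arbitrary: i rule: measure_induct_rule[of "area n Q"])
  case (less P)
  have n2: "n \<ge> 2" using n by simp
  have Q: "lattice_fun n k Q" and P: "lattice_fun n k P" and le: "\<And>d. Q d \<le> P d"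
    using less.prems(1) by (auto simp: nested_def)
  have level: "i = a" if "Q i = P i"
  proof (rule ccontr)
    assume "i \<noteq> a"
    then consider "i \<ge> a + 1" | "i \<le> a - 1" by linarith
    then show False
    proof cases
      case 1
      then show False using lattice_fun_bounds(1)[OF Q 1] a less.prems that by simp
    next
      case 2
      then show False using lattice_fun_bounds(1)[OF Q 2] a less.prems that by simp
    qed
  qed
  show ?case
  proof (cases "Q = P")
    case True
    then show ?thesis using level mult_left_id[OF n2] by (simp add: count_refl)
  next
    case False
    then obtain j where j: "corner P j" "Q j < P j" using corner_exists[OF less.prems(1) k] by blast
    note rem = box_removalI[OF n2 less.prems(1) j]
    have ne: "j mod int n \<noteq> l mod int n" if "P (l + 1) = P l + 1" for l
      using j(1) corner_cong[OF P, of j l] that by (auto simp: corner_def)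
    have ji: "j mod int n \<noteq> i mod int n" "(j + 1) mod int n \<noteq> i mod int n"
      using ne[of i] ne[of "i - 1"] less.prems mod_eq_add_iff[of j 1 "int n" "i - 1"] by auto
    show ?thesis
    proof (cases "j mod int n = (i + 1) mod int n")
      case False
      let ?P = "cut n j P"
      have "(i - 1) mod int n \<noteq> j mod int n" using ji mod_eq_add_iff[of "i - 1" 1 "int n" j] by auto
      then have "?P i = P i" "?P (i - 1) = P (i - 1)" "?P (i + 1) = P (i + 1)"
        using ji False by (auto simp: cut_def)
      then have "mult_left n a (count n k Q ?P) = mult_right n i (count n k Q ?P)"
        using less.IH[OF area_cut[OF n2 less.prems(1) j] nested_cut[OF n2 less.prems(1) j], of i] less.prems
        by simp
      moreover have "mult_right n i (mult_right n j c) = mult_right n j (mult_right n i c)" for c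
        using ji False by (intro mult_right_commute[OF n2]) auto
      ultimately show ?thesis
        by (simp add: count_removal[OF rem k] mult_left_right_commute[OF n2])
    next
      case True
      have c1: "corner P (i + 1)" "Q (i + 1) < P (i + 1)"
        using corner_cong[OF P True] less_cong[OF Q P True] j by auto
      note rem1 = box_removalI[OF n2 less.prems(1) c1]
      define P1 where "P1 = cut n (i + 1) P"
      have N1: "nested n k Q P1" unfolding P1_def by (rule nested_cut[OF n2 less.prems(1) c1])
      have small: "\<not> int n dvd 1" "\<not> int n dvd 2"
        using n zdvd_imp_le[of "int n" 2] by auto
      then have mods: "i mod int n \<noteq> (i + 1) mod int n" "(i + 2) mod int n \<noteq> (i + 1) mod int n"
        "(i + 2) mod int n \<noteq> i mod int n" "(i - 1) mod int n \<noteq> (i + 1) mod int n" 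
        by (auto simp: mod_eq_dvd_iff dvd_diff_commute)
      have P1: "P1 i = P i" "P1 (i + 1) = P i" "P1 (i - 1) = P i - 1" "P1 (i + 2) = P i + 1"
        using mods less.prems c1 by (auto simp: P1_def cut_def corner_def add.assoc)
      have "Q i < P i"
        using level le[of i] c1(2) less.prems a by fastforce
      then have c2: "corner P1 i" "Q i < P1 i" by (simp_all add: corner_def P1)
      note rem2 = box_removalI[OF n2 N1 c2]
      define P2 where "P2 = cut n i P1"
      have N2: "nested n k Q P2" unfolding P2_def by (rule nested_cut[OF n2 N1 c2])
      have P2: "P2 i = P i - 1" "P2 (i + 1) = P i" "P2 (i + 2) = P i + 1"
        using mods by (auto simp: P2_def cut_def P1)
      have "area n Q P2 < area n Q P"
        using area_cut[OF n2 less.prems(1) c1] area_cut[OF n2 N1 c2] by (simp add: P1_def P2_def)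
      then have IH: "mult_left n a (count n k Q P2) = mult_right n (i + 1) (count n k Q P2)"
        using less.IH[OF _ N2, of "i + 1"] P2 less.prems by (simp add: add.assoc)
      have "count n k Q P = mult_right n (i + 1) (mult_right n i (count n k Q P2))"
        using count_removal[OF rem1 k] count_removal[OF rem2 k] by (simp add: P1_def P2_def)
      then show ?thesis
        using IH mult_right_braid[OF n, of i] by (simp add: mult_left_right_commute[OF n2])
    qed
  qed
qed

section \<open>The strip of a lattice path\<close>

lemma step_count_step:
  "step_count P c j = step_count P c (j - 1) + (if step_at P j = c then 1 else 0)"
proof (cases "1 \<le> j")
  case True
  let ?A = "{i \<in> {1..j - 1}. step_at P i = c}"
  have "{i \<in> {1..j}. step_at P i = c} = (if step_at P j = c then insert j ?A else ?A)"
    using True by (auto simp: le_less)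
  moreover have "finite ?A" by (rule finite_subset[of _ "{1..j - 1}"]) auto
  moreover have "j \<notin> ?A" by simp
  ultimately show ?thesis using True by (simp add: step_count_def)
next
  case False
  let ?A = "{i \<in> {j + 1..0}. step_at P i = c}"
  have "{i \<in> {j - 1 + 1..0}. step_at P i = c} = (if step_at P j = c then insert j ?A else ?A)"
    using False by (auto simp: le_less)
  moreover have "finite ?A" by (rule finite_subset[of _ "{j + 1..0}"]) auto
  moreover have "j \<notin> ?A" by simp
  ultimately have *: "card {i \<in> {j - 1 + 1..0}. step_at P i = c} = card ?A + (if step_at P j = c then 1 else 0)"
    by simp
  show ?thesis
  proof (cases "j = 0")
    case True
    then show ?thesis using * by (simp add: step_count_def)
  next
    case False
    then show ?thesis using * \<open>\<not> 1 \<le> j\<close> by (simp add: step_count_def)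
  qed
qed

lemma step_count_0: "step_count P c 0 = 0"
  by (simp add: step_count_def)

lemma int_function_eqI:
  fixes F G :: "int \<Rightarrow> int"
  assumes "F 0 = G 0" "\<And>j. F j - F (j - 1) = G j - G (j - 1)"
  shows "F j = G j"
proof (induction j rule: int_induct[where k = 0])
  case (step1 j)
  then show ?case using assms(2)[of "j + 1"] by simp
next
  case (step2 j)
  then show ?case using assms(2)[of j] by simp
qed (rule assms(1))

lemma step_at_periodic: "length P = n \<Longrightarrow> step_at P (i + int n) = step_at P i"
  by (simp add: step_at_def diff_add_eq[symmetric])

lemma vertex_eq: "vertex P j = (step_count P Right j, j - step_count P Right j)"
proof -
  have "step_count P Up j = j - step_count P Right j"
  proof (rule int_function_eqI[where F = "step_count P Up" and G = "\<lambda>j. j - step_count P Right j"])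
    fix j show "step_count P Up j - step_count P Up (j - 1)
        = j - step_count P Right j - (j - 1 - step_count P Right (j - 1))"
      using step_count_step[of P Right j] step_count_step[of P Up j] by (cases "step_at P j") auto
  qed (simp add: step_count_0)
  then show ?thesis by (simp add: vertex_def)
qed

lemma lattice_fun_step_count:
  assumes "P \<in> lattice_paths k n"
  shows "lattice_fun n k (step_count P Right)"
proof -
  let ?X = "step_count P Right"
  have len: "length P = n" and Xn: "?X (int n) = int n - int k"
    using assms by (auto simp: lattice_paths_def vertex_def)
  have "?X (j + int n) = ?X j + (int n - int k)" for j
  proof (rule int_function_eqI[where F = "\<lambda>j. ?X (j + int n)" and G = "\<lambda>j. ?X j + (int n - int k)"])
    fix j
    have "?X (j + int n) = ?X (j - 1 + int n) + (if step_at P j = Right then 1 else 0)"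
      using step_count_step[of P Right "j + int n"] step_at_periodic[OF len, of j]
      by (simp add: algebra_simps)
    then show "?X (j + int n) - ?X (j - 1 + int n) = ?X j + (int n - int k) - (?X (j - 1) + (int n - int k))"
      using step_count_step[of P Right j] by simp
  qed (simp add: Xn step_count_0)
  moreover have "?X j = ?X (j - 1) \<or> ?X j = ?X (j - 1) + 1" for j
    using step_count_step[of P Right j] by auto
  ultimately show ?thesis by (simp add: lattice_fun_def)
qed

lemma south_edge_eq: "south_edge P i = path_edge (step_count P Right) i"
  using step_count_step[of P Right i]
  by (cases "step_at P i") (auto simp: south_edge_def vertex_eq path_edge_def)

text \<open>On a path this is the translation by \<open>(0, k)\<close>, which keeps \<open>x\<close>
  and raises antidiagonals by \<open>k\<close>. On a permutation it relabels only the sources, since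
  southern labels already are antidiagonals.\<close>

definition shifted :: "nat \<Rightarrow> (int \<Rightarrow> int) \<Rightarrow> int \<Rightarrow> int" where
  "shifted k X d = X (d - int k)"

lemma north_edge_eq: "north_edge k P i = path_edge (shifted k (step_count P Right)) (i + int k)"
proof -
  have "i + int k - 1 - int k = i - 1" by simp
  then show ?thesis
    by (auto simp: north_edge_def south_edge_eq path_edge_def shifted_def)
qed

lemma nested_shifted:
  assumes "lattice_fun n k X" shows "nested n k (shifted k X) X"
proof -
  have "shifted k X d = shifted k X (d - 1) \<or> shifted k X d = shifted k X (d - 1) + 1" for d
    using lattice_fun_step[OF assms, of "d - int k"] by (simp add: shifted_def algebra_simps)
  moreover have "shifted k X (d + int n) = shifted k X d + (int n - int k)" for d
    using lattice_fun_add_mult[OF assms, of "d - int k" 1] by (simp add: shifted_def algebra_simps)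
  moreover have "shifted k X d \<le> X d" for d
    using lattice_fun_bounds(1)[OF assms, of "d - int k" d] by (simp add: shifted_def)
  ultimately show ?thesis using assms by (simp add: nested_def lattice_fun_def)
qed

text \<open>The strip is described by columns and the region by antidiagonals. Monotonicity of the
  path gives one inclusion, a discrete intermediate value argument the other.\<close>

lemma strip_eq:
  assumes "P \<in> lattice_paths k n"
  shows "strip k P = region (shifted k (step_count P Right)) (step_count P Right)"
proof -
  let ?X = "step_count P Right"
  note X = lattice_fun_step_count[OF assms]
  have H: "south_edge P i = HEdge x h \<longleftrightarrow> ?X (i - 1) = x \<and> ?X i = x + 1 \<and> h = i - 1 - x" for i x h
    using lattice_fun_step[OF X, of i] by (auto simp: south_edge_eq path_edge_def)
  show ?thesis
  proof (intro equalityI subsetI)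
    fix b assume "b \<in> strip k P"
    then obtain x y i h where b: "b = (x, y)" and i: "?X (i - 1) = x" "?X i = x + 1" "h = i - 1 - x"
      "h \<le> y" "y < h + int k"
      by (auto simp: strip_def H)
    have "?X i \<le> ?X (x + y + 1)" "?X (x + y + 1 - int k) \<le> ?X (i - 1)"
      using i by (intro lattice_fun_bounds(1)[OF X]; simp)+
    then show "b \<in> region (shifted k ?X) ?X" using i b by (simp add: region_def shifted_def)
  next
    fix b assume "b \<in> region (shifted k ?X) ?X"
    then obtain x y where b: "b = (x, y)" and lo: "?X (x + y + 1 - int k) \<le> x" and hi: "x < ?X (x + y + 1)"
      by (auto simp: region_def shifted_def)
    have "\<exists>i. x + y + 1 - int k < i \<and> i \<le> x + y + 1 \<and> ?X (i - 1) = x \<and> ?X i = x + 1"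
    proof -
      have "\<exists>i. c < i \<and> i \<le> d \<and> ?X (i - 1) = x \<and> ?X i = x + 1"
        if "c \<le> d" "?X c \<le> x" "x < ?X d" for c d
        using that
      proof (induction d rule: int_ge_induct)
        case (step d)
        show ?case
        proof (cases "x < ?X d")
          case True
          then obtain i where "c < i" "i \<le> d" "?X (i - 1) = x" "?X i = x + 1" using step by blast
          then show ?thesis by (intro exI[of _ i]) simp
        next
          case False
          then show ?thesis
            using step lattice_fun_step[OF X, of "d + 1"] by (intro exI[of _ "d + 1"]) auto
        qed
      qed simp
      from this[of "x + y + 1 - int k" "x + y + 1"] lo hi show ?thesis by simp
    qed
    then obtain i where i: "x + y + 1 - int k < i" "i \<le> x + y + 1" "?X (i - 1) = x" "?X i = x + 1" by blast
    then have "south_edge P i = HEdge x (i - 1 - x)" by (simp add: H)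
    moreover have "i - 1 - x \<le> y" "y < i - 1 - x + int k" using i by simp_all
    ultimately show "b \<in> strip k P" unfolding b strip_def by blast
  qed
qed

lemma strand_eq_trace: "strand k P D i m = trace D (north_edge k P i) m"
  by (induction m) auto

text \<open>The numbers \<open>p\<close> and \<open>q\<close> of boxes before an elbow turn into a
  bound on \<open>pot\<close>, and the northern label \<open>i\<close> into the antidiagonal
  \<open>i + k\<close>.\<close>

lemma Deo_eq_deograms:
  assumes P: "P \<in> lattice_paths k n"
  shows "Deo k n f P =
    deograms n k (shifted k (step_count P Right)) (step_count P Right) (shifted k f)"
proof -
  let ?X = "step_count P Right"
  let ?Q = "shifted k ?X"
  have trav: "traverses k P D i m b \<longleftrightarrow>
      b \<in> dom D \<and> (\<exists>e. trace D (path_edge ?Q (i + int k)) m = Some e \<and> entered_box e = b)" for D i m b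
    by (simp add: traverses_def strand_eq_trace north_edge_eq)
  have visits: "b \<in> visits D (path_edge ?Q (i + int k)) \<longleftrightarrow> (\<exists>m. traverses k P D i m b)" for D i b
    by (auto simp: visits_def trav)
  have before: "(\<exists>p'<p. traverses k P D i p' c) \<longleftrightarrow> c \<in> visits D (path_edge ?Q (i + int k)) \<and> pot c < pot b"
    if "traverses k P D i p b" for D i p b c
  proof -
    have "pot c = pot (entered_box (path_edge ?Q (i + int k))) + int p'" if "traverses k P D i p' c" for p' c
      using that pot_trace unfolding trav by blast
    from this this[OF that] show ?thesis
      unfolding visits by (metis add_less_cancel_left of_nat_less_iff)
  qed
  have cross: "crossings_before k P D i p j q = {c \<in> crossings ?Q D (i + int k) (j + int k). pot c < pot b}"
    if "traverses k P D i p b" "traverses k P D j q b" for D i j p q b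
    unfolding crossings_before_def crossings_def
    using before[OF that(1)] before[OF that(2)] by blast
  have A: "periodic_filling k n P D \<longleftrightarrow> dom D = region ?Q ?X \<and> periodic n k D" for D
    by (simp add: periodic_filling_def periodic_def strip_eq[OF P])
  have B: "has_strand_perm k P D f \<longleftrightarrow> wired ?Q ?X D (shifted k f)" for D
  proof
    assume h: "has_strand_perm k P D f"
    show "wired ?Q ?X D (shifted k f)" unfolding wired_def
    proof
      fix d
      show "\<exists>m. trace D (path_edge ?Q d) m = Some (path_edge ?X (shifted k f d))"
        using h[unfolded has_strand_perm_def, rule_format, of "d - int k"]
        by (simp add: strand_eq_trace north_edge_eq south_edge_eq shifted_def)
    qed
  next
    assume w: "wired ?Q ?X D (shifted k f)"
    show "has_strand_perm k P D f" unfolding has_strand_perm_def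
    proof
      fix i
      show "\<exists>m. strand k P D i m = Some (south_edge P (f i))"
        using w[unfolded wired_def, rule_format, of "i + int k"]
        by (simp add: strand_eq_trace north_edge_eq south_edge_eq shifted_def)
    qed
  qed
  have C: "(\<forall>i j p q b. i \<noteq> j \<and> D b = Some Elbow \<and> traverses k P D i p b \<and> traverses k P D j q b
          \<longrightarrow> even (card (crossings_before k P D i p j q))) \<longleftrightarrow> distinguished ?Q D" (is "?L \<longleftrightarrow> _") for D
  proof
    assume L: ?L
    show "distinguished ?Q D" unfolding distinguished_def
    proof (intro allI impI, elim conjE)
      fix d d' b assume *: "d \<noteq> d'" "D b = Some Elbow" "b \<in> visits D (path_edge ?Q d)"
        "b \<in> visits D (path_edge ?Q d')"
      then obtain p q where pq: "traverses k P D (d - int k) p b" "traverses k P D (d' - int k) q b"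
        using visits[of b D "d - int k"] visits[of b D "d' - int k"] by auto
      moreover have "d - int k \<noteq> d' - int k" using * by simp
      ultimately have "even (card (crossings_before k P D (d - int k) p (d' - int k) q))"
        using L *(2) by blast
      then show "even (card {c \<in> crossings ?Q D d d'. pot c < pot b})"
        using cross[OF pq] by simp
    qed
  next
    assume dist: "distinguished ?Q D"
    show ?L
    proof (intro allI impI, elim conjE)
      fix i j p q b assume *: "i \<noteq> j" "D b = Some Elbow" "traverses k P D i p b" "traverses k P D j q b"
      have "b \<in> visits D (path_edge ?Q (i + int k))" "b \<in> visits D (path_edge ?Q (j + int k))"
        using *(3,4) visits by blast+
      moreover have "i + int k \<noteq> j + int k" using *(1) by simp
      ultimately show "even (card (crossings_before k P D i p j q))"
        unfolding cross[OF *(3,4)] by (intro distinguishedD[OF dist _ *(2)])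
    qed
  qed
  show ?thesis unfolding Deo_def deograms_def by (simp only: A B C conj_assoc)
qed

section \<open>Exchanging two neighbouring steps of a path\<close>

lemma length_swap_steps: "length (swap_steps i P) = length P"
  by (simp add: swap_steps_def)

lemma step_at_swap_steps:
  assumes n: "length P \<ge> 2"
  shows "step_at (swap_steps i P) l =
    (if l mod int (length P) = i mod int (length P) then step_at P (i + 1)
     else if l mod int (length P) = (i + 1) mod int (length P) then step_at P i
     else step_at P l)"
proof -
  let ?n = "int (length P)"
  have iff: "nat ((l - 1) mod ?n) = nat ((j - 1) mod ?n) \<longleftrightarrow> l mod ?n = j mod ?n" for j
  proof -
    have "0 < ?n" using n by linarith
    then have "0 \<le> (l - 1) mod ?n" "0 \<le> (j - 1) mod ?n" by (intro pos_mod_sign; assumption)+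
    then have "nat ((l - 1) mod ?n) = nat ((j - 1) mod ?n) \<longleftrightarrow> (l - 1) mod ?n = (j - 1) mod ?n"
      by (rule eq_nat_nat_iff)
    also have "\<dots> \<longleftrightarrow> l mod ?n = j mod ?n" using mod_eq_add_iff[of l "-1" ?n j] by simp
    finally show ?thesis .
  qed
  define a b m where "a = nat ((i - 1) mod ?n)" and "b = nat (i mod ?n)" and "m = nat ((l - 1) mod ?n)"
  have "m = a \<longleftrightarrow> l mod ?n = i mod ?n" unfolding a_def m_def by (rule iff)
  moreover have "m = b \<longleftrightarrow> l mod ?n = (i + 1) mod ?n"
    unfolding b_def m_def using iff[of "i + 1"] by simp
  moreover have "(i + 1) mod ?n \<noteq> i mod ?n" using succ_mod_neq[OF n] .
  moreover have "m < length P"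
  proof -
    have "0 < ?n" using n by linarith
    then have "0 \<le> (l - 1) mod ?n" "(l - 1) mod ?n < ?n" by (intro pos_mod_sign pos_mod_bound; assumption)+
    then show ?thesis by (simp add: m_def nat_less_iff)
  qed
  moreover have "step_at (swap_steps i P) l = P[a := step_at P (i + 1), b := step_at P i] ! m"
    by (simp add: step_at_def[of "swap_steps i P"] length_swap_steps m_def)
      (simp add: swap_steps_def a_def b_def)
  moreover have "step_at P l = P ! m" by (simp add: step_at_def m_def)
  ultimately show ?thesis by (auto simp: nth_list_update)
qed

definition bump :: "nat \<Rightarrow> int \<Rightarrow> int \<Rightarrow> int" where
  "bump n i d = (if d mod int n = i mod int n then 1 else 0)"

text \<open>The constant is nonzero only for \<open>i \<equiv> 0\<close>, when the swap moves the vertex \<open>0\<close>, which is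
  always placed at the origin.\<close>

lemma step_count_swap_steps:
  assumes n: "n \<ge> 2" and P: "length P = n"
    and e: "e = (if step_at P i = step_at P (i + 1) then 0 else if step_at P i = Right then -1 else 1)"
  obtains c where "step_count (swap_steps i P) Right = (\<lambda>d. step_count P Right d + e * bump n i d + c)"
proof
  let ?X = "step_count P Right" and ?X' = "step_count (swap_steps i P) Right"
  show "?X' = (\<lambda>d. ?X d + e * bump n i d + (- e * bump n i 0))"
  proof
    fix d
    let ?Y = "\<lambda>d. ?X d + e * bump n i d + (- e * bump n i 0)"
    show "?X' d = ?Y d"
    proof (rule int_function_eqI[where F = ?X' and G = ?Y])
      fix d
      define r where "r Q = (if step_at Q d = Right then 1 else 0 :: int)" for Q
      have X: "?X d - ?X (d - 1) = r P" "?X' d - ?X' (d - 1) = r (swap_steps i P)"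
        unfolding r_def by (subst step_count_step, simp)+
      have c: "step_at P a = step_at P b" if "a mod int n = b mod int n" for a b
        using mod_eq_add_iff[of a "-1" "int n" b] that P by (simp add: step_at_def)
      have succ: "d mod int n = (i + 1) mod int n \<longleftrightarrow> (d - 1) mod int n = i mod int n"
        using mod_eq_add_iff[of "d - 1" 1 "int n" i] by simp
      have sw: "step_at (swap_steps i P) d = (if d mod int n = i mod int n then step_at P (i + 1)
         else if (d - 1) mod int n = i mod int n then step_at P i else step_at P d)"
        using step_at_swap_steps[of P i d] n P unfolding succ[symmetric] by simp
      have "r (swap_steps i P) = r P + e * bump n i d - e * bump n i (d - 1)"
      proof -
        consider "d mod int n = i mod int n" "(d - 1) mod int n \<noteq> i mod int n"
          | "d mod int n \<noteq> i mod int n" "(d - 1) mod int n = i mod int n"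
          | "d mod int n \<noteq> i mod int n" "(d - 1) mod int n \<noteq> i mod int n"
          using succ_mod_neq[OF n, of "d - 1"] by fastforce
        then show ?thesis
        proof cases
          case 1
          then show ?thesis using c[of d i] sw
            by (cases "step_at P i"; cases "step_at P (i + 1)") (simp_all add: r_def bump_def e)
        next
          case 2
          then show ?thesis using c[of d "i + 1"] succ sw
            by (cases "step_at P i"; cases "step_at P (i + 1)") (simp_all add: r_def bump_def e)
        next
          case 3
          then show ?thesis using sw by (simp add: r_def bump_def)
        qed
      qed
      then show "?X' d - ?X' (d - 1) = ?Y d - ?Y (d - 1)" using X by linarith
    qed (simp add: step_count_0)
  qed
qed

lemma swap_steps_in_lattice_paths:
  assumes n: "n \<ge> 2" and P: "P \<in> lattice_paths k n"
  shows "swap_steps i P \<in> lattice_paths k n"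
proof -
  have len: "length P = n" and Xn: "step_count P Right (int n) = int n - int k"
    using P by (auto simp: lattice_paths_def vertex_def)
  obtain e c where X': "step_count (swap_steps i P) Right = (\<lambda>d. step_count P Right d + e * bump n i d + c)"
    using step_count_swap_steps[OF n len refl] by blast
  have "step_count (swap_steps i P) Right 0 = 0" by (simp add: step_count_0)
  then have "step_count (swap_steps i P) Right (int n) = step_count P Right (int n)"
    unfolding X' by (simp add: bump_def step_count_0)
  then show ?thesis by (simp add: lattice_paths_def length_swap_steps len vertex_eq Xn)
qed

section \<open>The commutation identity for strips\<close>

lemma shifted_cut: "shifted k (cut n i X) = cut n (i + int k) (shifted k X)"
proof
  fix d
  have "(d - int k) mod int n = i mod int n \<longleftrightarrow> d mod int n = (i + int k) mod int n"
    using mod_eq_add_iff[of "d - int k" "int k" "int n" i] by simp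
  then show "shifted k (cut n i X) d = cut n (i + int k) (shifted k X) d"
    by (simp add: shifted_def cut_def)
qed

text \<open>Both strips arise from the region between \<open>shifted k X\<close> and
  \<open>cut n i X\<close>: that of \<open>X\<close> by adding an orbit of boxes in the south, that
  of \<open>X'\<close>, up to translation, by adding the image of this orbit under
  \<open>(0, k)\<close> in the north.\<close>

lemma count_strip_corner:
  assumes n: "n \<ge> 2" and kn: "k \<le> n" and X: "lattice_fun n k X" and i: "corner X i"
    and X': "X' = (\<lambda>d. cut n i X d + c)"
  shows "mult_left n (i + int k) (count n k (shifted k X) X) = mult_right n i (count n k (shifted k X') X')"
proof -
  let ?Q = "shifted k X"
  \<comment> \<open>A corner uses a right and an up step, which excludes \<open>k = 0\<close> and
    \<open>k = n\<close>.\<close>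
  have "k \<noteq> 0"
  proof
    assume "k = 0"
    then show False
      using lattice_fun_add_mult[OF X, of i 1] lattice_fun_bounds(2)[OF X, of "i + 1" "i + int n"] i n
      by (simp add: corner_def)
  qed
  moreover have "k \<noteq> n"
  proof
    assume "k = n"
    then show False
      using lattice_fun_add_mult[OF X, of "i - 1" 1] lattice_fun_bounds(1)[OF X, of i "i - 1 + int n"] i n
      by (simp add: corner_def)
  qed
  ultimately have k: "0 < k" "k < n" using kn by auto
  have Qi: "?Q i < X i"
    using lattice_fun_bounds(1)[OF X, of "i - int k" "i - 1"] i k by (simp add: shifted_def corner_def)
  have QX: "nested n k ?Q X" by (rule nested_shifted[OF X])
  have QY: "nested n k ?Q (cut n i X)" using nested_cut[OF n QX i Qi] .
  have "i + int k - 1 - int k = i - 1" "i + int k + 1 - int k = i + 1" by simp_all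
  then have cQ: "corner ?Q (i + int k)" using i by (simp add: corner_def shifted_def)
  have "shifted k X' = (\<lambda>d. shifted k (cut n i X) d + c)" by (simp add: X' shifted_def fun_eq_iff)
  then have "count n k (shifted k X') X' = count n k (shifted k (cut n i X)) (cut n i X)"
    using count_translate[OF n nested_shifted[OF lattice_fun_cut[OF n X i]] disjI2[OF conjI[OF k]], of c]
    by (simp only: X')
  also have "\<dots> = mult_left n (i + int k) (count n k ?Q (cut n i X))"
    unfolding shifted_cut by (rule count_add_north[OF n QY k cQ])
  finally show ?thesis
    using count_removal[OF box_removalI[OF n QX i Qi] k] by (simp add: mult_left_right_commute[OF n])
qed

lemma count_strip_straight:
  assumes n: "n \<ge> 2" and kn: "k \<le> n" and X: "lattice_fun n k X"
    and i: "X i - X (i - 1) = X (i + 1) - X i"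
  shows "mult_left n (i + int k) (count n k (shifted k X) X) = mult_right n i (count n k (shifted k X) X)"
proof (cases "0 < k \<and> k < n")
  case False
  \<comment> \<open>Here the two boundaries coincide and \<open>i + k\<close> is congruent to
    \<open>i\<close>, so the claim is about the unit vector.\<close>
  then have k: "k = 0 \<or> k = n" using kn by auto
  then have "shifted k X = X"
    using lattice_fun_add_mult[OF X, of _ "-1"] by (auto simp: shifted_def fun_eq_iff)
  moreover have "mult_right n (i + int k) = mult_right n i"
    using k by (intro mult_right_cong) auto
  ultimately show ?thesis using mult_left_id[OF n, of "i + int k"] by (simp add: count_refl)
next
  case True
  then have k: "0 < k" "k < n" by auto
  \<comment> \<open>For \<open>n = 2\<close> and \<open>k = 1\<close> right and up steps alternate,
    so equal neighbouring steps are impossible. Hence the braid relation is available.\<close>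
  have "n \<noteq> 2"
  proof
    assume "n = 2"
    then have "X (i - 1 + 2) = X (i - 1) + 1"
      using lattice_fun_add_mult[OF X, of "i - 1" 1] k by simp
    moreover have "i - 1 + 2 = i + 1" by simp
    ultimately have "X (i + 1) = X (i - 1) + 1" by (simp only:)
    then have "2 * X i = 2 * X (i - 1) + 1" using i by simp
    then show False by presburger
  qed
  then have n3: "n \<ge> 3" using n by simp
  have QX: "nested n k (shifted k X) X" by (rule nested_shifted[OF X])
  show ?thesis
  proof (cases "X i = X (i - 1)")
    case True
    \<comment> \<open>At antidiagonal \<open>i + k\<close> the northern path is higher by
      \<open>k\<close> than \<open>P\<close> at \<open>i\<close>; going back one period lowers it by
      \<open>k\<close>, into the same rows. The horizontal case needs no such shift, as the
      translation by \<open>(0, k)\<close> preserves columns.\<close>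
    let ?a = "i + int k - int n"
    have Q: "shifted k X (?a + b) = X (i + b) - (int n - int k)" for b
      using lattice_fun_add_mult[OF X, of "i + b" "-1"] by (simp add: shifted_def algebra_simps)
    have "mult_left n ?a (count n k (shifted k X) X) = mult_right n i (count n k (shifted k X) X)"
      using Q[of 0] Q[of "-1"] Q[of 1] True i by (intro count_commute_up[OF n3 k QX]) simp_all
    moreover have "mult_left n ?a = mult_left n (i + int k)" by (rule mult_left_cong) simp
    ultimately show ?thesis by simp
  next
    case False
    then have 1: "X i = X (i - 1) + 1" using lattice_fun_step[OF X, of i] by simp
    have Q: "shifted k X (i + int k + b) = X (i + b)" for b
    proof -
      have "i + int k + b - int k = i + b" by simp
      then show ?thesis by (simp add: shifted_def)
    qed
    show ?thesis
      using Q[of 0] Q[of "-1"] Q[of 1] 1 i by (intro count_commute_right[OF n3 k QX]) simp_all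
  qed
qed

section \<open>From counting vectors to affine Deograms\<close>

lemma bounded_affineD: "f \<in> bounded_affine k n \<Longrightarrow> affine_perm n f"
  by (simp add: bounded_affine_def)

lemma inv_shifted:
  assumes "bij f" shows "inv (shifted k f) a = inv f a + int k"
proof -
  have "shifted k f (inv f a + int k) = a"
    using assms by (simp add: shifted_def bij_is_surj surj_f_inv_f)
  moreover have "inj (shifted k f)"
  proof (rule injI)
    fix x y assume "shifted k f x = shifted k f y"
    then have "x - int k = y - int k"
      using assms unfolding shifted_def by (meson bij_is_inj injD)
    then show "x = y" by simp
  qed
  ultimately show ?thesis by (metis inv_f_f)
qed

lemma affine_perm_shifted:
  assumes "affine_perm n f" shows "affine_perm n (shifted k f)"
proof -
  have "bij (shifted k f)"
  proof (rule bijI')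
    show "shifted k f x = shifted k f y \<longleftrightarrow> x = y" for x y
      using assms by (auto simp: shifted_def affine_perm_def bij_def inj_eq)
    show "\<exists>x. y = shifted k f x" for y
      using assms by (intro exI[of _ "inv f y + int k"])
        (simp add: shifted_def affine_perm_def bij_is_surj surj_f_inv_f)
  qed
  moreover have "shifted k f (a + int n) = shifted k f a + int n" for a
    using affine_perm_add_mult[OF assms, of "a - int k" 1] by (simp add: shifted_def algebra_simps)
  ultimately show ?thesis by (simp add: affine_perm_def)
qed

lemma shifted_mult_left:
  "shifted k (simple_refl n i \<cdot> f) = simple_refl n (i + int k) \<cdot> shifted k f"
  by (simp add: fun_eq_iff shifted_def aff_mult_def simple_refl_conj_shift)

lemma shifted_mult_right: "shifted k (f \<cdot> g) = shifted k f \<cdot> g"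
  by (simp add: fun_eq_iff shifted_def aff_mult_def)

lemma mult_left_shifted:
  assumes "affine_perm n f"
  shows "mult_left n (i + int k) c (shifted k f) =
    c (shifted k (simple_refl n i \<cdot> f)) + (if f i < f (i + 1) then c (shifted k f) else 0)"
proof -
  have "i + int k + 1 - int k = i + 1" by simp
  then have "shifted k f (i + int k) = f i" "shifted k f (i + int k + 1) = f (i + 1)"
    by (simp_all add: shifted_def)
  then show ?thesis
    using affine_perm_shifted[OF assms] by (simp add: mult_left_def shifted_mult_left)
qed

lemma mult_right_shifted:
  assumes "affine_perm n f"
  shows "mult_right n i c (shifted k f) =
    c (shifted k (f \<cdot> simple_refl n i)) + (if inv f i < inv f (i + 1) then c (shifted k f) else 0)"
  using affine_perm_shifted[OF assms] inv_shifted[of f k] assms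
  by (simp add: mult_right_def shifted_mult_right affine_perm_def)

lemma
  assumes n: "n \<ge> 2" and k: "k \<le> n" and P: "P \<in> lattice_paths k n" and f: "affine_perm n f"
  shows finite_Deo: "finite (Deo k n f P)"
    and card_Deo: "card (Deo k n f P) =
      count n k (shifted k (step_count P Right)) (step_count P Right) (shifted k f)"
proof -
  let ?X = "step_count P Right"
  have X: "lattice_fun n k ?X" by (rule lattice_fun_step_count[OF P])
  have "shifted k ?X = ?X" if "k = 0 \<or> k = n"
    using that lattice_fun_add_mult[OF X, of _ "-1"] by (auto simp: shifted_def fun_eq_iff)
  then show "finite (Deo k n f P)"
    unfolding Deo_eq_deograms[OF P]
    using k by (intro finite_deograms n nested_shifted[OF X] affine_perm_shifted[OF f]) auto
  show "card (Deo k n f P) = count n k (shifted k ?X) ?X (shifted k f)"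
    using affine_perm_shifted[OF f] by (simp add: Deo_eq_deograms[OF P] count_def)
qed

text \<open>Compares the coefficients of the commutation identity at one permutation. It is applied
  at \<open>s \<cdot> f\<close> and at \<open>f \<cdot> s\<close>, from which left or right
  multiplication by \<open>s\<close> leads back to the original \<open>f\<close>.\<close>

lemma card_Deo_swap:
  assumes n: "n \<ge> 2" and k: "k \<le> n" and P: "P \<in> lattice_paths k n" and P': "P' \<in> lattice_paths k n"
    and f: "affine_perm n f" and s: "s = simple_refl n i"
    and comm: "mult_left n (i + int k) (count n k (shifted k (step_count P Right)) (step_count P Right))
      = mult_right n i (count n k (shifted k (step_count P' Right)) (step_count P' Right))"
  shows "card (Deo k n (s \<cdot> f) P) + (if f i < f (i + 1) then card (Deo k n f P) else 0) =
    card (Deo k n (f \<cdot> s) P') + (if inv f i < inv f (i + 1) then card (Deo k n f P') else 0)"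
proof -
  note aff = affine_perm_mult[OF affine_perm_simple_refl[OF n] f] affine_perm_mult[OF f affine_perm_simple_refl[OF n]]
  show ?thesis
    unfolding s card_Deo[OF n k P f] card_Deo[OF n k P' f] card_Deo[OF n k P aff(1)] card_Deo[OF n k P' aff(2)]
    using fun_cong[OF comm, of "shifted k f"]
    unfolding mult_left_shifted[OF f] mult_right_shifted[OF f] .
qed

lemma step_at_eq_Right_iff: "step_at P i = Right \<longleftrightarrow> step_count P Right i = step_count P Right (i - 1) + 1"
  using step_count_step[of P Right i] by auto

lemma step_at_eq_Up_iff: "step_at P i = Up \<longleftrightarrow> step_count P Right i = step_count P Right (i - 1)"
  using step_count_step[of P Right i] by (cases "step_at P i") auto

theorem theorem1p4:
  fixes n k :: nat and f s :: "int \<Rightarrow> int" and P P' :: "step list" and i :: int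
  assumes "n \<ge> 2" and "k \<le> n"
    and "f \<in> bounded_affine k n" and "P \<in> lattice_paths k n" and "i \<in> {1..int n}"
    and s: "s = simple_refl n i" and P': "P' = swap_steps i P"
  shows
    "(aff_length n (s \<cdot> f \<cdot> s) = aff_length n f + 2 \<longrightarrow>
        (P' = P \<or> step_at P i = Right \<and> step_at P (i + 1) = Up \<longrightarrow>
           (\<exists>\<phi>. bij_betw \<phi> (Deo k n f P) (Deo k n (s \<cdot> f) P' <+> Deo k n (s \<cdot> f \<cdot> s) P')))
      \<and> (step_at P i = Up \<and> step_at P (i + 1) = Right \<longrightarrow>
           (\<exists>\<phi>. bij_betw \<phi> (Deo k n f P) (Deo k n (f \<cdot> s) P' <+> Deo k n (s \<cdot> f \<cdot> s) P'))))
   \<and> (aff_length n f = aff_length n (s \<cdot> f \<cdot> s)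
        \<and> aff_length n (s \<cdot> f) > aff_length n f \<and> aff_length n (f \<cdot> s) < aff_length n f \<longrightarrow>
        (P' = P \<or> step_at P i = Right \<and> step_at P (i + 1) = Up \<longrightarrow>
           (\<exists>\<phi>. bij_betw \<phi> (Deo k n f P) (Deo k n (s \<cdot> f \<cdot> s) P'))))"
proof -
  note n = assms(1) and k = assms(2) and P = assms(4)
  have f: "affine_perm n f" using assms(3) by (rule bounded_affineD)
  have P'_in: "P' \<in> lattice_paths k n" unfolding P' by (rule swap_steps_in_lattice_paths[OF n P])
  have len: "length P = n" using P by (simp add: lattice_paths_def)
  define X X' where "X = step_count P Right" and "X' = step_count P' Right"
  have X: "lattice_fun n k X" "lattice_fun n k X'"
    unfolding X_def X'_def by (intro lattice_fun_step_count P P'_in)+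
  have aff: "affine_perm n s" "affine_perm n (s \<cdot> f)" "affine_perm n (f \<cdot> s)" "affine_perm n (s \<cdot> f \<cdot> s)"
    unfolding s by (intro affine_perm_mult affine_perm_simple_refl n f)+
  have ss: "s \<cdot> (s \<cdot> g) = g" "g \<cdot> s \<cdot> s = g" for g
    unfolding s by (rule simple_refl_mult_self[OF n])+
  have sfs: "s \<cdot> (f \<cdot> s) = s \<cdot> f \<cdot> s" by (simp add: aff_mult_assoc)
  have fin: "finite (Deo k n f P)" "finite (Deo k n (s \<cdot> f) P')" "finite (Deo k n (f \<cdot> s) P')"
    "finite (Deo k n (s \<cdot> f \<cdot> s) P')"
    using finite_Deo[OF n k] P P'_in f aff by blast+
  have left: "if g i < g (i + 1) then aff_length n (s \<cdot> g) = aff_length n g + 1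
      else aff_length n g = aff_length n (s \<cdot> g) + 1" if "affine_perm n g" for g
    unfolding s by (rule aff_length_mult_left[OF n that])
  have right: "if inv g i < inv g (i + 1) then aff_length n (g \<cdot> s) = aff_length n g + 1
      else aff_length n g = aff_length n (g \<cdot> s) + 1" if "affine_perm n g" for g
    unfolding s by (rule aff_length_mult_right[OF n that])
  \<comment> \<open>Coefficient at \<open>s \<cdot> f\<close>: the left operator returns to
    \<open>f\<close> on \<open>P\<close>, the right one leads to
    \<open>s \<cdot> f \<cdot> s\<close> on \<open>P'\<close>.\<close>
  have down: "card (Deo k n f P) + (if (s \<cdot> f) i < (s \<cdot> f) (i + 1) then card (Deo k n (s \<cdot> f) P) else 0) =
      card (Deo k n (s \<cdot> f \<cdot> s) P')
      + (if inv (s \<cdot> f) i < inv (s \<cdot> f) (i + 1) then card (Deo k n (s \<cdot> f) P') else 0)"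
    if "P' = P \<or> step_at P i = Right \<and> step_at P (i + 1) = Up"
  proof -
    have "mult_left n (i + int k) (count n k (shifted k X) X) = mult_right n i (count n k (shifted k X') X')"
      using that
    proof
      assume eq: "P' = P"
      have "swap_steps i P = P" unfolding P'[symmetric] by (rule eq)
      then have "step_at P i = step_at P (i + 1)"
        using step_at_swap_steps[of P i i] n len by simp
      then have "X i - X (i - 1) = X (i + 1) - X i"
        using step_at_eq_Right_iff[of P i] step_at_eq_Right_iff[of P "i + 1"]
          step_at_eq_Up_iff[of P i] step_at_eq_Up_iff[of P "i + 1"]
        by (cases "step_at P i") (auto simp: X_def)
      moreover have "X' = X" by (simp only: X_def X'_def eq)
      ultimately show ?thesis using count_strip_straight[OF n k X(1)] by simp
    next
      assume RU: "step_at P i = Right \<and> step_at P (i + 1) = Up"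
      then obtain c where "X' = (\<lambda>d. X d + (-1) * bump n i d + c)"
        using step_count_swap_steps[OF n len, of "-1" i] unfolding X_def X'_def P' by auto
      then have "X' = (\<lambda>d. cut n i X d + c)" by (simp add: cut_def bump_def)
      moreover have "corner X i"
        using RU step_at_eq_Right_iff[of P i] step_at_eq_Up_iff[of P "i + 1"] by (simp add: corner_def X_def)
      ultimately show ?thesis by (intro count_strip_corner[OF n k X(1)])
    qed
    from card_Deo_swap[OF n k P P'_in aff(2) s this[unfolded X_def X'_def]]
    show ?thesis by (simp only: ss)
  qed
  \<comment> \<open>Now it is \<open>P'\<close> that has the corner, so the paths exchange their
    roles and the coefficient at \<open>f \<cdot> s\<close> is taken.\<close>
  have up: "card (Deo k n (s \<cdot> f \<cdot> s) P') + (if (f \<cdot> s) i < (f \<cdot> s) (i + 1) then card (Deo k n (f \<cdot> s) P') else 0) =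
      card (Deo k n f P) + (if inv (f \<cdot> s) i < inv (f \<cdot> s) (i + 1) then card (Deo k n (f \<cdot> s) P) else 0)"
    if UR: "step_at P i = Up \<and> step_at P (i + 1) = Right"
  proof -
    obtain c where c: "X' = (\<lambda>d. X d + 1 * bump n i d + c)"
      using UR step_count_swap_steps[OF n len, of 1 i] unfolding X_def X'_def P' by auto
    have "X = (\<lambda>d. cut n i X' d + (- c))" by (simp add: c cut_def bump_def fun_eq_iff)
    moreover have "corner X' i"
    proof -
      have "(i - 1) mod int n \<noteq> i mod int n" "(i + 1) mod int n \<noteq> i mod int n"
        using succ_mod_neq[OF n, of i] succ_mod_neq[OF n, of "i - 1"] by auto
      then show ?thesis
        using UR step_at_eq_Up_iff[of P i] step_at_eq_Right_iff[of P "i + 1"]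
        by (simp add: corner_def c bump_def X_def)
    qed
    ultimately have "mult_left n (i + int k) (count n k (shifted k X') X') = mult_right n i (count n k (shifted k X) X)"
      by (intro count_strip_corner[OF n k X(2)])
    from card_Deo_swap[OF n k P'_in P aff(3) s this[unfolded X_def X'_def]]
    show ?thesis by (simp only: ss sfs)
  qed
  have A_down: "\<exists>\<phi>. bij_betw \<phi> (Deo k n f P) (Deo k n (s \<cdot> f) P' <+> Deo k n (s \<cdot> f \<cdot> s) P')"
    if "aff_length n (s \<cdot> f \<cdot> s) = aff_length n f + 2"
      and "P' = P \<or> step_at P i = Right \<and> step_at P (i + 1) = Up"
  proof -
    \<comment> \<open>The length grows by 1 from \<open>f\<close> to \<open>s \<cdot> f\<close> and
      again to \<open>s \<cdot> f \<cdot> s\<close>. So \<open>s \<cdot> f\<close> has a left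
      descent and a right ascent, and only the conditional term on \<open>P'\<close>
      survives.\<close>
    have "\<not> (s \<cdot> f) i < (s \<cdot> f) (i + 1)" "inv (s \<cdot> f) i < inv (s \<cdot> f) (i + 1)"
      using that(1) left[OF f] left[OF aff(2), unfolded ss] right[OF aff(2)] by presburger+
    then show ?thesis
      using down[OF that(2)] fin by (simp add: bij_betw_iff_card card_Plus)
  qed
  have A_up: "\<exists>\<phi>. bij_betw \<phi> (Deo k n f P) (Deo k n (f \<cdot> s) P' <+> Deo k n (s \<cdot> f \<cdot> s) P')"
    if "aff_length n (s \<cdot> f \<cdot> s) = aff_length n f + 2"
      and "step_at P i = Up \<and> step_at P (i + 1) = Right"
  proof -
    have "(f \<cdot> s) i < (f \<cdot> s) (i + 1)" "\<not> inv (f \<cdot> s) i < inv (f \<cdot> s) (i + 1)"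
      using that(1) right[OF f] left[OF aff(3), unfolded sfs] right[OF aff(3), unfolded ss] by presburger+
    then show ?thesis
      using up[OF that(2)] fin by (simp add: bij_betw_iff_card card_Plus)
  qed
  have B: "\<exists>\<phi>. bij_betw \<phi> (Deo k n f P) (Deo k n (s \<cdot> f \<cdot> s) P')"
    if "aff_length n f = aff_length n (s \<cdot> f \<cdot> s)" "aff_length n (s \<cdot> f) > aff_length n f"
      and "P' = P \<or> step_at P i = Right \<and> step_at P (i + 1) = Up"
  proof -
    \<comment> \<open>Now \<open>s \<cdot> f\<close> has descents on both sides, so both conditional
      terms vanish.\<close>
    have "\<not> (s \<cdot> f) i < (s \<cdot> f) (i + 1)" "\<not> inv (s \<cdot> f) i < inv (s \<cdot> f) (i + 1)"
      using that(1,2) left[OF f] left[OF aff(2), unfolded ss] right[OF aff(2)] by presburger+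
    then show ?thesis
      using down[OF that(3)] fin by (simp add: bij_betw_iff_card)
  qed
  show ?thesis using A_down A_up B by blast
qed

end
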